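(* The operation $+_R$ (addition of decimals) on the canonical encoding $X_R$ of decimals is weakly computable.
   Context: $\mathbb{N}=\{1,2,\dots\}$, $\mathbb{N}_0=\{0,1,2,\dots\}$, $D=\{0,1,\dots,9\}$. **Decimals.** A decimal is a formal infinite linear combination $d=(-)\sum_{n\le k}d_n10^n$ with an optional minus sign, $k\in\mathbb{N}_0$ (the order of $d$), $n\in\mathbb{Z}$, $d_n\in D$, such that (i) $d_k=0$ implies $k=0$; (ii) there is no $n\le k$ with $d_m=9$ for all $m\le n$; (iii) $-\sum_{n\le 0}0\cdot10^n$ is not allowed. Digits $d_n$ with $n>k$ are set to $0$. Two decimals are equal iff they have equal signs, orders and digits. $\mathbb{R}$ denotes the set of decimals. **Addition of decimals.** Let $\mathbb{Q}_D\subset\mathbb{Q}$ be the subring of fractions with a finite decimal expansion. For a decimal $d=(-)\sum_{n\le k}d_n10^n\in\mathbb{R}$ of order $k$ and $m\in\mathbb{N}$ let $r(d\,|\,m)=\pm\sum_{-m\le n\le k}d_n10^n\in\mathbb{Q}_D$ (with the sign of $d$) be the value of the $m$-th truncation of $d$. A sequence $(a_n)\subset\mathbb{Q}_D$ is Cauchy if for every $k\in\mathbb{N}$ there is $n_0\in\mathbb{N}$ with $|a_m-a_n|<1/k$ for all $m,n\ge n_0$. A Cauchy sequence $(a_n)\subset\mathbb{Q}_D$ generates $d$, written $d=G(a_n)$, if for every $k\in\mathbb{N}$ there is $n_0\in\mathbb{N}$ such that $|r(d\,|\,n)-a_n|<1/k$ for all $n\ge n_0$. Every decimal has a generating sequence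 and every Cauchy sequence in $\mathbb{Q}_D$ generates exactly one decimal. For $d=G(a_n)$, $e=G(b_n)$ one defines $d+_Re:=G(a_n+b_n)$ (independent of the choice of generating sequences). **Encodings and operations.** For a nonempty finite alphabet $A$ let $A^{\infty}=A^{\mathbb{N}_0}$ be the set of one-way infinite words over $A$. An encoding is a nonempty subset $X\subset A^\infty$. An operation on $X$ is a map $F\colon X\times X\to X$. **Canonical encoding $X_R$.** Let $A=D\cup\{-,\xi\}$, with $\xi$ a separation symbol. A decimal $d=(-)\sum_{n\le k}d_n10^n$ of order $k$ is encoded as the word $u(d)\in A^\infty$ consisting of the minus sign if $d$ has one, then the binary digits of $k$ (least significant digit first; $0$ is written as the single digit $0$), then $\xi$, then the digits $d_k,d_{k-1},d_{k-2},\dots$ in this order. $X_R=\{u(d)\mid d\in\mathbb{R}\}$, and $+_R$ is transported to $X_R$ via the bijection $d\mapsto u(d)$. **Machines.** A machine $M$ (for an encoding $X\subset A^\infty$) is a Turing machine with a finite set of states containing an initial state and a terminal state, and with a finite alphabet $A'\supset A\cup\{0,1,\epsilon\}$, where $\epsilon\in A'\setminus A$ is the empty cell symbol. It operates on three bi-infinite tapes $T_1,T_2,T_3$, with cells labeled by $\mathbb{Z}$, via corresponding heads $H_1,H_2,H_3$; $H_1,H_2$ only read, $H_3$ reads and writes. The words $x=x_0x_1\dots$ and $y=y_0y_1\dots$ in $X$ are stored on $T_1$ and $T_2$, respectively, with the $n$-th letter in cell $n$ and $\epsilon$ in every cell $n<0$; finite numerical input is stored in binary on $T_3$ starting at cell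 $0$, least significant digit first, the remaining cells containing $\epsilon$. The computation starts in the initial state with every head at cell $0$. In each step, if $M$ is in the terminal state the computation terminates; otherwise, depending only on the current state and the contents of the three currently scanned cells, $M$ rewrites the scanned cell of $T_3$, moves each head by $-1$, $0$ or $+1$, and passes to a new (possibly the same) state, according to its finite instruction table. **Weak computability.** A machine $M$ weakly computes an operation $F\colon X\times X\to X$ if for every pair $(x,y)\in X^2$ there exists a number $h=h(x,y)\in\mathbb{N}$ such that for every $m\in\mathbb{N}_0$ the computation of $M$ on the input with $x$ on $T_1$, $y$ on $T_2$, and both $m$ and $h$ in binary on $T_3$ (in a fixed layout, e.g. $m$, a separating symbol, $h$) terminates with $z_m$ in cell $0$ of $T_3$ and $\epsilon$ in all other cells of $T_3$, where $F(x,y)=z_0z_1z_2\dots$. (The number $h$ may depend on $(x,y)$ but not on $m$; no computability of $h$ is required.) $F$ is weakly computable if some machine weakly computes it. *)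

theory Defs
  imports Complex_Main "HOL-Library.Omega_Words_Fun"
begin

section \<open>Decimals and their addition\<close>

record raw_decimal =
  dec_neg :: bool
  dec_order :: nat
  dec_digit :: "int \<Rightarrow> nat"

text \<open>
  The digits above the order are fixed to be zero, so equality of records is equality of signs,
  orders and digits. The last conjunct excludes the negatively signed zero.
\<close>

definition decimals :: "raw_decimal set" where
  "decimals = {d.
     (\<forall>n. dec_digit d n \<in> {0..9}) \<and>
     (\<forall>n > int (dec_order d). dec_digit d n = 0) \<and>
     (dec_digit d (int (dec_order d)) = 0 \<longrightarrow> dec_order d = 0) \<and>
     \<not> (\<exists>n \<le> int (dec_order d). \<forall>m \<le> n. dec_digit d m = 9) \<and>
     \<not> (dec_neg d \<and> dec_order d = 0 \<and> (\<forall>n \<le> 0. dec_digit d n = 0))}"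

definition finite_decimal_fractions :: "rat set" where
  "finite_decimal_fractions = {q. \<exists>(a::int) (n::nat). q = of_int a / 10 ^ n}"

definition trunc_value :: "raw_decimal \<Rightarrow> nat \<Rightarrow> rat" where
  "trunc_value d m = (if dec_neg d then -1 else 1) *
     (\<Sum>n \<in> {- int m .. int (dec_order d)}. of_nat (dec_digit d n) * 10 powi n)"

text \<open>
  Sequences of fractions are indexed by the positive integers; the value at index 0 is ignored.
\<close>

definition fraction_Cauchy :: "(nat \<Rightarrow> rat) \<Rightarrow> bool" where
  "fraction_Cauchy a \<longleftrightarrow>
     (\<forall>n \<ge> 1. a n \<in> finite_decimal_fractions) \<and>
     (\<forall>k::nat \<ge> 1. \<exists>n0 \<ge> 1. \<forall>m \<ge> n0. \<forall>n \<ge> n0. \<bar>a m - a n\<bar> < 1 / of_nat k)"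

definition generates :: "(nat \<Rightarrow> rat) \<Rightarrow> raw_decimal \<Rightarrow> bool" where
  "generates a d \<longleftrightarrow> fraction_Cauchy a \<and> d \<in> decimals \<and>
     (\<forall>k::nat \<ge> 1. \<exists>n0 \<ge> 1. \<forall>n \<ge> n0. \<bar>trunc_value d n - a n\<bar> < 1 / of_nat k)"

definition generated_decimal :: "(nat \<Rightarrow> rat) \<Rightarrow> raw_decimal" where
  "generated_decimal a = (THE d. generates a d)"

definition decimal_add :: "raw_decimal \<Rightarrow> raw_decimal \<Rightarrow> raw_decimal" where
  "decimal_add d e = (THE s. \<exists>a b. generates a d \<and> generates b e \<and>
     s = generated_decimal (\<lambda>n. a n + b n))"


section \<open>Encodings and operations\<close>

text \<open>
  All finite alphabets are finite subsets of one infinite supply of symbols. The symbols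
  \<open>Digit 0\<close> and \<open>Digit 1\<close> are at the same time the binary digits, \<open>Blank\<close> is the empty cell
  symbol, and \<open>Sep\<close> separates the two numerical inputs of a machine. The symbols \<open>Aux n\<close> are
  available to machines as further tape symbols.
\<close>

datatype symbol = Digit nat | Minus | Xi | Blank | Sep | Aux nat

definition encoding :: "symbol set \<Rightarrow> symbol word set \<Rightarrow> bool" where
  "encoding A X \<longleftrightarrow> finite A \<and> A \<noteq> {} \<and> X \<noteq> {} \<and> (\<forall>x \<in> X. range x \<subseteq> A)"

definition operation :: "symbol word set \<Rightarrow> (symbol word \<Rightarrow> symbol word \<Rightarrow> symbol word) \<Rightarrow> bool" where
  "operation X F \<longleftrightarrow> (\<forall>x \<in> X. \<forall>y \<in> X. F x y \<in> X)"

text \<open>Binary digits, least significant first; zero is written as a single digit.\<close>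

fun binary :: "nat \<Rightarrow> symbol list" where
  "binary k = (if k < 2 then [Digit k] else Digit (k mod 2) # binary (k div 2))"

declare binary.simps [simp del]

definition decimal_alphabet :: "symbol set" where
  "decimal_alphabet = Digit ` {0..9} \<union> {Minus, Xi}"

definition encode :: "raw_decimal \<Rightarrow> symbol word" where
  "encode d = ((if dec_neg d then [Minus] else []) @ binary (dec_order d) @ [Xi])
     \<frown> (\<lambda>i. Digit (dec_digit d (int (dec_order d) - int i)))"

definition X_R :: "symbol word set" where
  "X_R = encode ` decimals"

definition decode :: "symbol word \<Rightarrow> raw_decimal" where
  "decode = the_inv_into decimals encode"

definition add_R :: "symbol word \<Rightarrow> symbol word \<Rightarrow> symbol word" where
  "add_R x y = encode (decimal_add (decode x) (decode y))"


section \<open>Machines\<close>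

datatype move = Bwd | Stay | Fwd

fun shift :: "move \<Rightarrow> int" where
  "shift Bwd = -1"
| "shift Stay = 0"
| "shift Fwd = 1"

text \<open>
  The instruction \<open>instr M q a b c\<close> is performed in state \<open>q\<close> when the three heads scan
  \<open>a\<close>, \<open>b\<close>, \<open>c\<close>. It consists of the new state, the symbol written on the third tape, and the moves
  of the three heads. Only its values on states and tape symbols of \<open>M\<close> are relevant, so this is a
  finite table.
\<close>

record machine =
  states :: "nat set"
  initial :: nat
  terminal :: nat
  tape_symbols :: "symbol set"
  instr :: "nat \<Rightarrow> symbol \<Rightarrow> symbol \<Rightarrow> symbol \<Rightarrow> nat \<times> symbol \<times> move \<times> move \<times> move"

definition wf_machine :: "symbol set \<Rightarrow> machine \<Rightarrow> bool" where
  "wf_machine A M \<longleftrightarrow>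
     finite (states M) \<and> initial M \<in> states M \<and> terminal M \<in> states M \<and>
     finite (tape_symbols M) \<and> A \<union> {Digit 0, Digit 1, Blank, Sep} \<subseteq> tape_symbols M \<and> Blank \<notin> A \<and>
     (\<forall>q \<in> states M - {terminal M}.
        \<forall>a \<in> tape_symbols M. \<forall>b \<in> tape_symbols M. \<forall>c \<in> tape_symbols M.
          case instr M q a b c of (q', c', _) \<Rightarrow> q' \<in> states M \<and> c' \<in> tape_symbols M)"

type_synonym tape = "int \<Rightarrow> symbol"

definition word_tape :: "symbol word \<Rightarrow> tape" where
  "word_tape x = (\<lambda>n. if n < 0 then Blank else x (nat n))"

definition list_tape :: "symbol list \<Rightarrow> tape" where
  "list_tape w = (\<lambda>n. if 0 \<le> n \<and> n < int (length w) then w ! nat n else Blank)"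

record config =
  state :: nat
  head1 :: int
  head2 :: int
  head3 :: int
  work_tape :: tape

definition step :: "machine \<Rightarrow> tape \<Rightarrow> tape \<Rightarrow> config \<Rightarrow> config" where
  "step M T1 T2 c =
     (if state c = terminal M then c
      else case instr M (state c) (T1 (head1 c)) (T2 (head2 c)) (work_tape c (head3 c)) of
        (q, s, m1, m2, m3) \<Rightarrow>
          \<lparr> state = q,
            head1 = head1 c + shift m1,
            head2 = head2 c + shift m2,
            head3 = head3 c + shift m3,
            work_tape = (work_tape c)(head3 c := s) \<rparr>)"

definition initial_config :: "machine \<Rightarrow> tape \<Rightarrow> config" where
  "initial_config M T3 =
     \<lparr> state = initial M, head1 = 0, head2 = 0, head3 = 0, work_tape = T3 \<rparr>"

definition terminates_with :: "machine \<Rightarrow> tape \<Rightarrow> tape \<Rightarrow> tape \<Rightarrow> tape \<Rightarrow> bool" where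
  "terminates_with M T1 T2 T3 T3' \<longleftrightarrow>
     (\<exists>t. let c = (step M T1 T2 ^^ t) (initial_config M T3)
          in state c = terminal M \<and> work_tape c = T3')"


section \<open>Weak computability\<close>

text \<open>
  The numerical input \<open>m\<close>, \<open>h\<close> occupies the third tape as the binary digits of \<open>m\<close>, the symbol
  \<open>Sep\<close>, and the binary digits of \<open>h\<close>, starting at cell 0.
\<close>

definition weakly_computes ::
  "symbol word set \<Rightarrow> (symbol word \<Rightarrow> symbol word \<Rightarrow> symbol word) \<Rightarrow> machine \<Rightarrow> bool" where
  "weakly_computes X F M \<longleftrightarrow>
     (\<forall>x \<in> X. \<forall>y \<in> X. \<exists>h \<ge> 1. \<forall>m.
        terminates_with M (word_tape x) (word_tape y)
          (list_tape (binary m @ [Sep] @ binary h))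
          (list_tape [F x y m]))"

definition weakly_computable ::
  "symbol set \<Rightarrow> symbol word set \<Rightarrow> (symbol word \<Rightarrow> symbol word \<Rightarrow> symbol word) \<Rightarrow> bool" where
  "weakly_computable A X F \<longleftrightarrow>
     encoding A X \<and> operation X F \<and> (\<exists>M. wf_machine A M \<and> weakly_computes X F M)"

end

theory Submission
  imports Defs "HOL-Library.Countable"
begin

text \<open>
  Write \<open>s\<close> for the sum of two decimals \<open>d\<close> and \<open>e\<close>, and \<open>z\<close> for the word that encodes \<open>s\<close>. The only
  obstacle to computing \<open>z\<close> from the words of \<open>d\<close> and \<open>e\<close> is finite: the signs and the order of \<open>s\<close>
  cannot be found effectively, and a carry may have to be awaited forever. All of this is moved into
  the number \<open>h\<close>, which may depend on \<open>d\<close> and \<open>e\<close> in any way whatsoever.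

  \<^item> If \<open>z\<close> is eventually constantly \<open>0\<close>, then \<open>h\<close> only has to contain a finite prefix of \<open>z\<close>.

  \<^item> Otherwise \<open>h\<close> contains the prefix of \<open>z\<close> that ends just before the units digit, the positions of
    the units digits in the words of \<open>d\<close> and \<open>e\<close>, and the signs relative to that of \<open>s\<close>. The later
    digits are computed by column addition. An operand whose sign is opposite to that of \<open>s\<close> is
    replaced by its nines' complement, so that subtraction becomes addition as well: in a column
    sum \<open>v\<close> of digits from \<open>0\<close> to \<open>18\<close>, the carry out of a column is decided by the column alone
    unless \<open>v = 9\<close>, in which case the carry is passed on. Hence the digit of \<open>s\<close> at position \<open>n\<close> is
    known once the first column below \<open>n\<close> with sum different from \<open>9\<close> has been found
    (\<open>sum_digit\<close>). If there were no such column, the sum would be an integer multiple of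
    \<open>10\<close> to the \<open>n\<close>, and \<open>z\<close> would end in zeros (\<open>sum_terminates\<close>).

  The machine reads \<open>h\<close> as a program in a tiny language, so that a single machine serves both cases and
  all operands. No work space is needed: the two input tapes are blank to the left of cell \<open>0\<close>, and so
  their heads serve as counters that can be tested against cell \<open>-1\<close>. First \<open>m\<close> is counted down on the
  third tape while both input heads move forward from cell \<open>-1\<close> to cell \<open>m - 1\<close> (\<open>countdown\<close>). Each
  letter of the stored prefix then moves them one cell back, unless the first head already stands on a
  blank, which happens exactly at the letter of index \<open>m\<close>. Once the whole prefix, of length \<open>l\<close> say, has
  been passed, both heads stand at cell \<open>m - l - 1\<close>; moving each of them forward by a constant brings
  them to the column of the digit that is sought.

  That addition of decimals, defined through generating sequences, is addition of real numbers
  (\<open>decimal_add\<close>) rests on the bijection between decimals and real numbers given by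
  \<open>decimal_value\<close> and \<open>decimal_of_real\<close>: the digits of a decimal are the last digits of the integral
  parts of its magnitude divided by powers of ten (\<open>digit_eq_floor\<close>).
\<close>

section \<open>The real value of a decimal\<close>

text \<open>
  The digits of \<open>d\<close> down to position \<open>n\<close>, read as an integer.
\<close>

definition prefix_value :: "raw_decimal \<Rightarrow> int \<Rightarrow> int" where
  "prefix_value d n = (\<Sum>j\<in>{n..int (dec_order d)}. int (dec_digit d j) * 10 ^ nat (j - n))"

lemma digit_le_9: "d \<in> decimals \<Longrightarrow> dec_digit d n \<le> 9"
  by (auto simp: decimals_def)

lemma prefix_value_above: "n > int (dec_order d) \<Longrightarrow> prefix_value d n = 0"
  by (simp add: prefix_value_def)

lemma prefix_value_step:
  assumes "d \<in> decimals"
  shows "prefix_value d n = 10 * prefix_value d (n + 1) + int (dec_digit d n)"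
proof (cases "n \<le> int (dec_order d)")
  case True
  then have split: "{n..int (dec_order d)} = insert n {n + 1..int (dec_order d)}" by auto
  have "int (dec_digit d j) * 10 ^ nat (j - n)
      = 10 * (int (dec_digit d j) * 10 ^ nat (j - (n + 1)))" if "j \<in> {n + 1..int (dec_order d)}" for j
  proof -
    have "nat (j - n) = Suc (nat (j - (n + 1)))" using that by auto
    then show ?thesis by simp
  qed
  then have "(\<Sum>j\<in>{n + 1..int (dec_order d)}. int (dec_digit d j) * 10 ^ nat (j - n))
      = 10 * prefix_value d (n + 1)"
    unfolding prefix_value_def sum_distrib_left by (rule sum.cong[OF refl])
  with split show ?thesis by (simp add: prefix_value_def)
next
  case False
  with assms have "dec_digit d n = 0" by (auto simp: decimals_def)
  with False show ?thesis by (simp add: prefix_value_above)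
qed

lemma digit_eq_prefix_mod:
  assumes "d \<in> decimals"
  shows "int (dec_digit d n) = prefix_value d n mod 10"
  using digit_le_9[OF assms, of n] by (simp add: prefix_value_step[OF assms, of n])

abbreviation lower :: "raw_decimal \<Rightarrow> int \<Rightarrow> real" where
  "lower d n \<equiv> of_int (prefix_value d n) * 10 powi n"

abbreviation upper :: "raw_decimal \<Rightarrow> int \<Rightarrow> real" where
  "upper d n \<equiv> (of_int (prefix_value d n) + 1) * 10 powi n"

lemma powi_Suc: "(10::real) powi (n + 1) = 10 * 10 powi n"
  by (simp add: power_int_add)

lemma lower_step:
  assumes "d \<in> decimals"
  shows "lower d n = lower d (n + 1) + real (dec_digit d n) * 10 powi n"
  unfolding prefix_value_step[OF assms, of n] powi_Suc by (simp add: algebra_simps)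

lemma upper_step:
  assumes "d \<in> decimals"
  shows "upper d (n + 1) = upper d n + (9 - real (dec_digit d n)) * 10 powi n"
  unfolding prefix_value_step[OF assms, of n] powi_Suc by (simp add: algebra_simps)

text \<open>
  The intervals from \<open>lower d n\<close> to \<open>upper d n\<close> shrink as \<open>n\<close> decreases, because a digit lies between \<open>0\<close>
  and \<open>9\<close>. The magnitude of \<open>d\<close> is the point that they enclose.
\<close>

lemma lower_antimono:
  assumes "d \<in> decimals" "m \<le> n"
  shows "lower d n \<le> lower d m"
  using assms(2)
proof (induction m rule: int_le_induct)
  case (step i)
  then show ?case using lower_step[OF assms(1), of "i - 1"] by (simp add: order.trans)
qed simp

lemma upper_mono:
  assumes "d \<in> decimals" "m \<le> n"
  shows "upper d m \<le> upper d n"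
  using assms(2)
proof (induction m rule: int_le_induct)
  case (step i)
  have "(9 - real (dec_digit d (i - 1))) * 10 powi (i - 1) \<ge> 0"
    using digit_le_9[OF assms(1), of "i - 1"] by (intro mult_nonneg_nonneg) auto
  then have "upper d (i - 1) \<le> upper d i"
    using upper_step[OF assms(1), of "i - 1"] by simp
  with step show ?case by linarith
qed simp

lemma lower_less_upper:
  assumes "d \<in> decimals"
  shows "lower d m < upper d n"
proof -
  have "lower d m \<le> lower d (min m n)" by (rule lower_antimono[OF assms]) simp
  also have "\<dots> < upper d (min m n)" by simp
  also have "\<dots> \<le> upper d n" by (rule upper_mono[OF assms]) simp
  finally show ?thesis .
qed

definition magnitude :: "raw_decimal \<Rightarrow> real" where
  "magnitude d = (SUP n. lower d n)"

lemma lower_le_magnitude: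
  assumes "d \<in> decimals"
  shows "lower d n \<le> magnitude d"
  unfolding magnitude_def
  by (rule cSUP_upper) (auto intro!: bdd_aboveI[of _ "upper d 0"] less_imp_le lower_less_upper[OF assms])

text \<open>
  This is where a tail of nines is excluded: below every position there is a digit other than \<open>9\<close>, and
  such a digit makes the upper end of the enclosing interval strictly smaller. The strict inequality is
  what identifies integral parts in \<open>floor_magnitude\<close>.
\<close>

lemma magnitude_less_upper:
  assumes "d \<in> decimals"
  shows "magnitude d < upper d n"
proof -
  have "min (n - 1) (int (dec_order d)) \<le> int (dec_order d)" by simp
  with assms obtain m where m: "m \<le> min (n - 1) (int (dec_order d))" "dec_digit d m \<noteq> 9"
    unfolding decimals_def by blast
  have "magnitude d \<le> upper d m" unfolding magnitude_def
    by (rule cSUP_least) (auto intro: less_imp_le lower_less_upper[OF assms])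
  also have "upper d m < upper d (m + 1)"
  proof -
    have "(9 - real (dec_digit d m)) * 10 powi m > 0"
      using m(2) digit_le_9[OF assms, of m] by (intro mult_pos_pos) auto
    then show ?thesis using upper_step[OF assms, of m] by simp
  qed
  also have "\<dots> \<le> upper d n" by (rule upper_mono[OF assms]) (use m(1) in simp)
  finally show ?thesis .
qed

lemma floor_magnitude:
  assumes "d \<in> decimals"
  shows "\<lfloor>magnitude d / 10 powi n\<rfloor> = prefix_value d n"
proof (rule floor_unique)
  show "of_int (prefix_value d n) \<le> magnitude d / 10 powi n"
    using lower_le_magnitude[OF assms, of n] by (simp add: pos_le_divide_eq)
  show "magnitude d / 10 powi n < of_int (prefix_value d n) + 1"
    using magnitude_less_upper[OF assms, of n] by (simp add: pos_divide_less_eq)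
qed

lemma magnitude_nonneg:
  assumes "d \<in> decimals"
  shows "magnitude d \<ge> 0"
  using lower_le_magnitude[OF assms, of "int (dec_order d) + 1"] by (simp add: prefix_value_above)

lemma digit_eq_floor:
  assumes "d \<in> decimals"
  shows "int (dec_digit d n) = \<lfloor>magnitude d / 10 powi n\<rfloor> mod 10"
  by (simp add: floor_magnitude[OF assms] digit_eq_prefix_mod[OF assms])

definition decimal_value :: "raw_decimal \<Rightarrow> real" where
  "decimal_value d = (if dec_neg d then -1 else 1) * magnitude d"

text \<open>
  A decimal with minus sign has a nonzero magnitude, since the negatively signed zero is no decimal. So
  the sign can be recovered from the value.
\<close>

lemma neg_iff_value:
  assumes "d \<in> decimals"
  shows "dec_neg d \<longleftrightarrow> decimal_value d < 0"
proof -
  have "magnitude d \<noteq> 0" if "dec_neg d"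
  proof
    assume "magnitude d = 0"
    then have "dec_digit d n = 0" for n using digit_eq_floor[OF assms, of n] by simp
    with assms that show False by (auto simp: decimals_def)
  qed
  then show ?thesis using magnitude_nonneg[OF assms] by (auto simp: decimal_value_def)
qed

lemma abs_decimal_value: "d \<in> decimals \<Longrightarrow> \<bar>decimal_value d\<bar> = magnitude d"
  using magnitude_nonneg by (auto simp: decimal_value_def)

lemma decimal_value_inject:
  assumes "d \<in> decimals" "e \<in> decimals" "decimal_value d = decimal_value e"
  shows "d = e"
proof -
  have neg: "dec_neg d = dec_neg e" using assms by (simp add: neg_iff_value)
  have "magnitude d = magnitude e" using assms by (metis abs_decimal_value)
  then have digit: "dec_digit d n = dec_digit e n" for n
    using digit_eq_floor[OF assms(1), of n] digit_eq_floor[OF assms(2), of n] by simp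
  have order: "dec_order a \<le> dec_order b"
    if "a \<in> decimals" "b \<in> decimals" "dec_digit a = dec_digit b" for a b
  proof (rule ccontr)
    assume "\<not> dec_order a \<le> dec_order b"
    then have "dec_digit b (int (dec_order a)) = 0" "dec_order a \<noteq> 0"
      using that by (auto simp: decimals_def)
    then show False using that by (auto simp: decimals_def)
  qed
  have "dec_order d = dec_order e"
    using order[of d e] order[of e d] digit assms by (simp add: ext le_antisym)
  with neg digit show ?thesis by (cases d; cases e) auto
qed

definition decimal_of_real :: "real \<Rightarrow> raw_decimal" where
  "decimal_of_real r =
     \<lparr> dec_neg = (r < 0),
       dec_order = (LEAST k. \<bar>r\<bar> < 10 ^ (k + 1)),
       dec_digit = (\<lambda>n. nat (\<lfloor>\<bar>r\<bar> / 10 powi n\<rfloor> mod 10)) \<rparr>"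

text \<open>
  Division by a further power of ten moves the last digit of the integral part into the fractional part.
\<close>

lemma frac_step:
  "10 * frac (r / 10 powi (n + 1)) = of_int (\<lfloor>r / 10 powi n\<rfloor> mod 10) + frac (r / 10 powi n)" for r :: real
proof -
  let ?q = "\<lambda>n. r / 10 powi n"
  have q: "?q n = 10 * ?q (n + 1)" by (simp add: powi_Suc)
  have "\<lfloor>?q (n + 1)\<rfloor> = \<lfloor>?q n / of_int 10\<rfloor>" by (simp add: q)
  also have "\<dots> = \<lfloor>?q n\<rfloor> div 10" by (subst floor_divide_real_eq_div) auto
  finally have "\<lfloor>?q n\<rfloor> = 10 * \<lfloor>?q (n + 1)\<rfloor> + \<lfloor>?q n\<rfloor> mod 10" by simp
  then have "real_of_int \<lfloor>?q n\<rfloor> = 10 * of_int \<lfloor>?q (n + 1)\<rfloor> + of_int (\<lfloor>?q n\<rfloor> mod 10)"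
    by (metis of_int_add of_int_mult of_int_numeral)
  then show ?thesis using q by (simp add: frac_def algebra_simps)
qed

lemma floor_step:
  "\<lfloor>r / 10 powi n\<rfloor> = 10 * \<lfloor>r / 10 powi (n + 1)\<rfloor> + \<lfloor>r / 10 powi n\<rfloor> mod 10" for r :: real
proof -
  have "real_of_int \<lfloor>r / 10 powi n\<rfloor>
      = of_int (10 * \<lfloor>r / 10 powi (n + 1)\<rfloor> + \<lfloor>r / 10 powi n\<rfloor> mod 10)"
    using frac_step[of r n] by (simp add: frac_def powi_Suc)
  then show ?thesis by (simp only: of_int_eq_iff)
qed

text \<open>
  A nonzero distance that grows tenfold with every further digit cannot stay bounded. This turns
  statements about infinitely many digits into equalities of real numbers.
\<close>

lemma tenfold_bounded_imp_zero:
  fixes g :: "int \<Rightarrow> real"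
  assumes "\<And>m. m < n \<Longrightarrow> g m = 10 * g (m + 1)" and "\<And>m. \<bar>g m\<bar> \<le> B"
  shows "g n = 0"
proof (rule ccontr)
  assume nz: "g n \<noteq> 0"
  have g: "g (n - int i) = 10 ^ i * g n" for i
  proof (induction i)
    case (Suc i)
    have "g (n - int (Suc i)) = 10 * g (n - int i)"
      using assms(1)[of "n - int (Suc i)"] by (simp add: algebra_simps)
    then show ?case using Suc by simp
  qed simp
  obtain i where i: "B / \<bar>g n\<bar> < 10 ^ i" using real_arch_pow[of 10] by auto
  then have "B < 10 ^ i * \<bar>g n\<bar>" using nz by (simp add: field_simps)
  with assms(2)[of "n - int i"] show False by (simp add: g abs_mult)
qed

text \<open>
  The digits add up to the integral parts of \<open>\<bar>r\<bar>\<close> divided by powers of ten, so \<open>\<bar>r\<bar>\<close> and the magnitude of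
  the decimal lie in the same intervals at every scale.
\<close>

lemma decimal_of_real:
  shows decimal_of_real_in: "decimal_of_real r \<in> decimals"
    and decimal_value_of_real: "decimal_value (decimal_of_real r) = r"
proof -
  let ?d = "decimal_of_real r" and ?q = "\<lambda>n. \<lfloor>\<bar>r\<bar> / 10 powi n\<rfloor>"
  let ?k = "dec_order ?d"
  have dig: "int (dec_digit ?d n) = ?q n mod 10" for n by (simp add: decimal_of_real_def)
  have neg: "dec_neg ?d \<longleftrightarrow> r < 0" by (simp add: decimal_of_real_def)
  obtain k0 where "\<bar>r\<bar> < 10 ^ k0" using real_arch_pow[of 10 "\<bar>r\<bar>"] by auto
  then have "\<bar>r\<bar> < 10 ^ (k0 + 1)" by (smt (verit) power_increasing_iff le_add1 power_increasing)
  then have k: "\<bar>r\<bar> < 10 ^ (?k + 1)"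
    unfolding decimal_of_real_def by (simp del: power_Suc add: LeastI[of "\<lambda>k. \<bar>r\<bar> < 10 ^ Suc k"])
  have above: "?q n = 0" if "n > int ?k" for n
  proof -
    have "\<bar>r\<bar> < 10 powi (int (?k + 1))" using k by (simp only: power_int_of_nat)
    also have "\<dots> \<le> 10 powi n" using that by (intro power_int_increasing) auto
    finally show ?thesis by (simp add: floor_eq_iff pos_divide_less_eq)
  qed
  have top: "?q ?k \<noteq> 0" if pos: "?k \<noteq> 0"
  proof -
    obtain k' where k': "?k = Suc k'" using pos by (cases ?k) auto
    have "?k = (LEAST k. \<bar>r\<bar> < 10 ^ (k + 1))"
      by (simp only: decimal_of_real_def raw_decimal.select_convs)
    then have "k' < (LEAST k. \<bar>r\<bar> < 10 ^ (k + 1))" using k' by linarith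
    then have "\<not> \<bar>r\<bar> < 10 ^ (k' + 1)" by (rule not_less_Least)
    then have "\<bar>r\<bar> / 10 powi ?k \<ge> 1" unfolding k' power_int_of_nat by (simp add: field_simps)
    then show ?thesis by linarith
  qed
  have qk: "?q ?k = ?q ?k mod 10" using floor_step[of "\<bar>r\<bar>" "int ?k"] above[of "int ?k + 1"] by simp
  have nines: "\<not> (\<forall>m\<le>n. dec_digit ?d m = 9)" for n
  proof
    assume nine: "\<forall>m\<le>n. dec_digit ?d m = 9"
    \<comment> \<open>a tail of nines would force the fractional part to equal 1\<close>
    let ?g = "\<lambda>m. 1 - frac (\<bar>r\<bar> / 10 powi m)"
    have "?g n = 0"
    proof (rule tenfold_bounded_imp_zero[where B = 1])
      fix m assume "m < n"
      then have "?q m mod 10 = 9" using nine dig[of m] by simp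
      then show "?g m = 10 * ?g (m + 1)" using frac_step[of "\<bar>r\<bar>" m] by simp
    next
      fix m show "\<bar>?g m\<bar> \<le> 1"
        using frac_lt_1[of "\<bar>r\<bar> / 10 powi m"] frac_ge_0[of "\<bar>r\<bar> / 10 powi m"] by simp
    qed
    then show False using frac_lt_1[of "\<bar>r\<bar> / 10 powi n"] by simp
  qed
  have zero: "r = 0" if "?k = 0" "\<forall>n\<le>0. dec_digit ?d n = 0"
  proof -
    have "?q n mod 10 = 0" for n
      using dig[of n] that above[of n] by (cases "n \<le> 0") auto
    then have fr: "10 * frac (\<bar>r\<bar> / 10 powi (n + 1)) = frac (\<bar>r\<bar> / 10 powi n)" for n
      using frac_step[of "\<bar>r\<bar>" n] by simp
    have "frac (\<bar>r\<bar> / 10 powi 0) = 0"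
      by (rule tenfold_bounded_imp_zero[where B = 1])
        (use fr in \<open>auto simp: less_imp_le frac_lt_1\<close>)
    moreover have "?q 0 = 0" using qk that \<open>?q 0 mod 10 = 0\<close> by simp
    ultimately show ?thesis by (simp add: frac_def)
  qed
  show mem: "?d \<in> decimals"
    unfolding decimals_def
  proof (intro CollectI conjI allI impI)
    fix n show "dec_digit ?d n \<in> {0..9}"
    proof -
      have "?q n mod 10 < 10" by simp
      then have "int (dec_digit ?d n) < 10" by (simp only: dig)
      then show ?thesis by simp
    qed
  next
    fix n assume "n > int ?k"
    then show "dec_digit ?d n = 0" using dig[of n] above[of n] by simp
  next
    assume "dec_digit ?d (int ?k) = 0"
    then show "?k = 0" using top qk dig[of "int ?k"] by auto
  next
    show "\<not> (\<exists>n\<le>int ?k. \<forall>m\<le>n. dec_digit ?d m = 9)" using nines by blast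
  next
    show "\<not> (dec_neg ?d \<and> ?k = 0 \<and> (\<forall>n\<le>0. dec_digit ?d n = 0))"
      using zero neg by (metis less_irrefl)
  qed
  have prefix: "prefix_value ?d n = ?q n" for n
  proof (cases "n > int ?k")
    case False
    then have "n \<le> int ?k + 1" by simp
    then show ?thesis
    proof (induction n rule: int_le_induct)
      case base
      then show ?case by (simp add: above prefix_value_above)
    next
      case (step i)
      then show ?case
        using prefix_value_step[OF mem, of "i - 1"] floor_step[of "\<bar>r\<bar>" "i - 1"] by (simp add: dig)
    qed
  qed (simp add: above prefix_value_above)
  let ?x = "magnitude ?d"
  let ?h = "\<lambda>n. (?x - \<bar>r\<bar>) / 10 powi n"
  have "?h 0 = 0"
  proof (rule tenfold_bounded_imp_zero[where B = 1])
    fix m :: int show "?h m = 10 * ?h (m + 1)" unfolding powi_Suc by (simp add: field_simps)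
    have "\<lfloor>?x / 10 powi m\<rfloor> = \<lfloor>\<bar>r\<bar> / 10 powi m\<rfloor>"
      by (simp only: floor_magnitude[OF mem] prefix)
    then show "\<bar>?h m\<bar> \<le> 1" unfolding diff_divide_distrib by linarith
  qed
  then show "decimal_value ?d = r" by (simp add: decimal_value_def neg)
qed

lemma of_rat_powi: "real_of_rat (10 powi n) = 10 powi n"
  by (auto simp: power_int_def of_rat_power of_rat_inverse of_rat_divide)

text \<open>
  Truncations are the lower ends of the enclosing intervals, up to the sign. This transfers everything
  said about generating sequences of fractions to the real line.
\<close>

lemma of_rat_trunc_value:
  "real_of_rat (trunc_value d m) = (if dec_neg d then -1 else 1) * lower d (- int m)"
proof -
  have "lower d (- int m) = (\<Sum>j\<in>{- int m..int (dec_order d)}. real (dec_digit d j) * 10 powi j)"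
    unfolding prefix_value_def of_int_sum sum_distrib_right
  proof (rule sum.cong)
    fix j assume "j \<in> {- int m..int (dec_order d)}"
    then have "(10::real) powi j = 10 powi int (nat (j + int m)) * 10 powi (- int m)"
      by (subst power_int_add[symmetric]) auto
    then have "(10::real) powi j = 10 ^ nat (j + int m) * 10 powi (- int m)"
      by (simp only: power_int_of_nat)
    then show "real_of_int (int (dec_digit d j) * 10 ^ nat (j - - int m)) * 10 powi - int m
        = real (dec_digit d j) * 10 powi j" by simp
  qed simp
  then show ?thesis
    by (simp add: trunc_value_def of_rat_mult of_rat_sum of_rat_powi of_rat_minus)
qed

lemma trunc_value_tendsto:
  assumes "d \<in> decimals"
  shows "(\<lambda>m. real_of_rat (trunc_value d m)) \<longlonglongrightarrow> decimal_value d"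
proof -
  have "\<bar>lower d (- int m) - magnitude d\<bar> \<le> inverse (10 ^ m)" for m
    using lower_le_magnitude[OF assms, of "- int m"] magnitude_less_upper[OF assms, of "- int m"]
    by (simp add: power_int_minus algebra_simps)
  then have "\<bar>real_of_rat (trunc_value d m) - decimal_value d\<bar> \<le> inverse (10 ^ m)" for m
    by (simp add: of_rat_trunc_value decimal_value_def abs_minus_commute)
  then have "(\<lambda>m. real_of_rat (trunc_value d m) - decimal_value d) \<longlonglongrightarrow> 0"
    by (intro metric_tendsto_imp_tendsto[OF LIMSEQ_inverse_realpow_zero[of 10]]
        always_eventually) (auto simp: dist_real_def)
  then show ?thesis by (rule LIM_zero_cancel)
qed

lemma abs_less_real_of_rat:
  "\<bar>x - y\<bar> < 1 / of_nat k \<longleftrightarrow> \<bar>real_of_rat x - real_of_rat y\<bar> < 1 / real k"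
proof -
  have "\<bar>real_of_rat x - real_of_rat y\<bar> < 1 / real k
      \<longleftrightarrow> real_of_rat \<bar>x - y\<bar> < real_of_rat (1 / of_nat k)"
    by (simp add: of_rat_diff of_rat_divide abs_of_rat[symmetric] del: of_rat_less abs_of_rat)
  then show ?thesis by (simp only: of_rat_less)
qed

lemma tendsto_iff_inverse_nat:
  fixes f :: "nat \<Rightarrow> real"
  shows "f \<longlonglongrightarrow> l \<longleftrightarrow> (\<forall>k::nat\<ge>1. \<exists>n0\<ge>1. \<forall>n\<ge>n0. \<bar>f n - l\<bar> < 1 / real k)"
proof
  assume f: "f \<longlonglongrightarrow> l"
  show "\<forall>k::nat\<ge>1. \<exists>n0\<ge>1. \<forall>n\<ge>n0. \<bar>f n - l\<bar> < 1 / real k"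
  proof (intro allI impI)
    fix k :: nat assume "1 \<le> k"
    then have "0 < 1 / real k" by simp
    from LIMSEQ_D[OF f this] obtain N where "\<And>n. n \<ge> N \<Longrightarrow> \<bar>f n - l\<bar> < 1 / real k" by auto
    then show "\<exists>n0\<ge>1. \<forall>n\<ge>n0. \<bar>f n - l\<bar> < 1 / real k" by (intro exI[of _ "max 1 N"]) auto
  qed
next
  assume R: "\<forall>k::nat\<ge>1. \<exists>n0\<ge>1. \<forall>n\<ge>n0. \<bar>f n - l\<bar> < 1 / real k"
  show "f \<longlonglongrightarrow> l"
  proof (rule LIMSEQ_I)
    fix r :: real assume "0 < r"
    then obtain k where "inverse (real (Suc k)) < r" using reals_Archimedean by blast
    moreover obtain n0 where "\<forall>n\<ge>n0. \<bar>f n - l\<bar> < 1 / real (Suc k)" using R[rule_format, of "Suc k"] by auto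
    ultimately show "\<exists>no. \<forall>n\<ge>no. norm (f n - l) < r"
      by (intro exI[of _ n0]) (fastforce simp: inverse_eq_divide)
  qed
qed

lemma fraction_Cauchy_iff:
  "fraction_Cauchy a \<longleftrightarrow>
     (\<forall>n\<ge>1. a n \<in> finite_decimal_fractions) \<and> convergent (\<lambda>n. real_of_rat (a n))"
proof -
  let ?R = "\<forall>k::nat\<ge>1. \<exists>n0\<ge>1. \<forall>m\<ge>n0. \<forall>n\<ge>n0. \<bar>real_of_rat (a m) - real_of_rat (a n)\<bar> < 1 / real k"
  have "?R \<longleftrightarrow> Cauchy (\<lambda>n. real_of_rat (a n))"
  proof
    assume ?R
    show "Cauchy (\<lambda>n. real_of_rat (a n))"
    proof (rule CauchyI)
      fix r :: real assume "0 < r"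
      then obtain k where "inverse (real (Suc k)) < r" using reals_Archimedean by blast
      moreover obtain n0 where "\<forall>m\<ge>n0. \<forall>n\<ge>n0. \<bar>real_of_rat (a m) - real_of_rat (a n)\<bar> < 1 / real (Suc k)"
        using \<open>?R\<close>[rule_format, of "Suc k"] by auto
      ultimately show "\<exists>M. \<forall>m\<ge>M. \<forall>n\<ge>M. norm (real_of_rat (a m) - real_of_rat (a n)) < r"
        by (intro exI[of _ n0]) (fastforce simp: inverse_eq_divide)
    qed
  next
    assume C: "Cauchy (\<lambda>n. real_of_rat (a n))"
    show ?R
    proof (intro allI impI)
      fix k :: nat assume "1 \<le> k"
      then have "0 < 1 / real k" by simp
      from CauchyD[OF C this] obtain N
        where "\<forall>m\<ge>N. \<forall>n\<ge>N. \<bar>real_of_rat (a m) - real_of_rat (a n)\<bar> < 1 / real k" by auto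
      then show "\<exists>n0\<ge>1. \<forall>m\<ge>n0. \<forall>n\<ge>n0. \<bar>real_of_rat (a m) - real_of_rat (a n)\<bar> < 1 / real k"
        by (intro exI[of _ "max 1 N"]) auto
    qed
  qed
  then show ?thesis
    by (simp add: fraction_Cauchy_def abs_less_real_of_rat Cauchy_convergent_iff)
qed

text \<open>
  Seen in the reals, a sequence generates \<open>d\<close> if and only if it converges to the value of \<open>d\<close>, because
  the truncations of \<open>d\<close> do so.
\<close>

lemma generates_iff:
  "generates a d \<longleftrightarrow> d \<in> decimals \<and> (\<forall>n\<ge>1. a n \<in> finite_decimal_fractions) \<and>
     (\<lambda>n. real_of_rat (a n)) \<longlonglongrightarrow> decimal_value d"
proof -
  have "((\<lambda>n. real_of_rat (trunc_value d n) - real_of_rat (a n)) \<longlonglongrightarrow> 0)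
      \<longleftrightarrow> (\<lambda>n. real_of_rat (a n)) \<longlonglongrightarrow> decimal_value d" if "d \<in> decimals"
  proof
    assume "(\<lambda>n. real_of_rat (trunc_value d n) - real_of_rat (a n)) \<longlonglongrightarrow> 0"
    from tendsto_diff[OF trunc_value_tendsto[OF that] this]
    show "(\<lambda>n. real_of_rat (a n)) \<longlonglongrightarrow> decimal_value d" by simp
  next
    assume "(\<lambda>n. real_of_rat (a n)) \<longlonglongrightarrow> decimal_value d"
    from tendsto_diff[OF trunc_value_tendsto[OF that] this]
    show "(\<lambda>n. real_of_rat (trunc_value d n) - real_of_rat (a n)) \<longlonglongrightarrow> 0" by simp
  qed
  then show ?thesis
    unfolding generates_def fraction_Cauchy_iff abs_less_real_of_rat
    using tendsto_iff_inverse_nat[of "\<lambda>n. real_of_rat (trunc_value d n) - real_of_rat (a n)" 0]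
    by (auto simp: convergent_def)
qed

lemma trunc_value_fraction: "trunc_value d m \<in> finite_decimal_fractions"
proof -
  let ?p = "(if dec_neg d then - 1 else 1) * prefix_value d (- int m)"
  have "real_of_rat (trunc_value d m) = real_of_rat (of_int ?p / 10 ^ m)"
    by (simp add: of_rat_trunc_value of_rat_divide of_rat_mult of_rat_power power_int_minus
        divide_inverse of_rat_minus of_rat_inverse)
  then show ?thesis unfolding finite_decimal_fractions_def of_rat_eq_iff by blast
qed

lemma fractions_add:
  assumes "p \<in> finite_decimal_fractions" "q \<in> finite_decimal_fractions"
  shows "p + q \<in> finite_decimal_fractions"
proof -
  obtain a b :: int and m n :: nat where "p = of_int a / 10 ^ m" "q = of_int b / 10 ^ n"
    using assms by (auto simp: finite_decimal_fractions_def)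
  then have "p + q = of_int (a * 10 ^ n + b * 10 ^ m) / 10 ^ (m + n)"
    by (simp add: power_add add_frac_eq)
  then show ?thesis unfolding finite_decimal_fractions_def by blast
qed

text \<open>
  Limits are additive and decimals are determined by their values, so the two definite descriptions in
  the definition of addition denote unique objects.
\<close>

lemma decimal_add_eq:
  assumes "d \<in> decimals" "e \<in> decimals"
  shows "decimal_add d e = decimal_of_real (decimal_value d + decimal_value e)" (is "_ = ?s")
proof -
  have gen: "generated_decimal (\<lambda>n. a n + b n) = ?s" if "generates a d" "generates b e" for a b
    unfolding generated_decimal_def
  proof (rule the_equality)
    have lim: "(\<lambda>n. real_of_rat (a n + b n)) \<longlonglongrightarrow> decimal_value d + decimal_value e"
      using that by (auto simp: generates_iff of_rat_add intro: tendsto_add)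
    then show "generates (\<lambda>n. a n + b n) ?s"
      using that by (simp add: generates_iff decimal_of_real fractions_add)
    fix s assume s: "generates (\<lambda>n. a n + b n) s"
    then have "decimal_value s = decimal_value ?s"
      using LIMSEQ_unique[OF _ lim] by (simp add: generates_iff decimal_of_real)
    with s show "s = ?s"
      by (auto simp: generates_iff decimal_of_real_in intro: decimal_value_inject)
  qed
  have "generates (trunc_value d) d" "generates (trunc_value e) e"
    using assms by (auto simp: generates_iff trunc_value_fraction trunc_value_tendsto)
  with gen show ?thesis
    unfolding decimal_add_def by (intro the_equality) (metis, auto)
qed

lemma decimal_add:
  assumes "d \<in> decimals" "e \<in> decimals"
  shows "decimal_add d e \<in> decimals"
    and "decimal_value (decimal_add d e) = decimal_value d + decimal_value e"
  by (simp_all add: decimal_add_eq[OF assms] decimal_of_real)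

section \<open>The digits of a sum\<close>

definition nines_complement :: "bool \<Rightarrow> nat \<Rightarrow> nat" where
  "nines_complement c n = (if c then 9 - n else n)"

definition column :: "bool \<Rightarrow> bool \<Rightarrow> raw_decimal \<Rightarrow> raw_decimal \<Rightarrow> int \<Rightarrow> nat" where
  "column c1 c2 d e n = nines_complement c1 (dec_digit d n) + nines_complement c2 (dec_digit e n)"

text \<open>
  The contribution of the digits below position \<open>n\<close>, in units of \<open>10\<close> to the \<open>n\<close>, when \<open>d\<close> enters a sum
  directly or, if \<open>c\<close> holds, with its digits complemented. The complement of all digits of a fraction
  \<open>f\<close> represents \<open>1 - f\<close>.
\<close>

definition tail :: "bool \<Rightarrow> raw_decimal \<Rightarrow> int \<Rightarrow> real" where
  "tail c d n = (let f = frac (magnitude d / 10 powi n) in if c then 1 - f else f)"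

lemma tail_step:
  assumes "d \<in> decimals"
  shows "10 * tail c d (n + 1) = real (nines_complement c (dec_digit d n)) + tail c d n"
proof -
  have "10 * frac (magnitude d / 10 powi (n + 1)) = real (dec_digit d n) + frac (magnitude d / 10 powi n)"
    by (simp add: frac_step digit_eq_floor[OF assms, symmetric])
  then show ?thesis
    using digit_le_9[OF assms, of n] by (auto simp: tail_def nines_complement_def Let_def of_nat_diff)
qed

lemma tail_bounds: "0 \<le> tail c d n" "tail c d n \<le> 1" "\<not> c \<Longrightarrow> tail c d n < 1"
  using frac_lt_1[of "magnitude d / 10 powi n"] frac_ge_0[of "magnitude d / 10 powi n"]
  by (auto simp: tail_def Let_def)

text \<open>
  A negative operand is split into a smaller integer and a nonnegative tail. The additional \<open>-1\<close> is the
  one by which the tens' complement exceeds the nines' complement.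
\<close>

lemma signed_magnitude_tail:
  "(if c then -1 else 1) * (magnitude d / 10 powi n)
     = of_int (if c then - \<lfloor>magnitude d / 10 powi n\<rfloor> - 1 else \<lfloor>magnitude d / 10 powi n\<rfloor>) + tail c d n"
  by (auto simp: tail_def frac_def Let_def)

lemma carry_step:
  assumes "d \<in> decimals" "e \<in> decimals"
  shows "10 * (tail c1 d (n + 1) + tail c2 e (n + 1))
     = real (column c1 c2 d e n) + (tail c1 d n + tail c2 e n)"
  using tail_step[OF assms(1), of c1 n] tail_step[OF assms(2), of c2 n]
  by (simp add: column_def)

text \<open>
  The carry into position \<open>n\<close> is the integral part of the sum of the two tails. Both tails together are
  less than \<open>2\<close>, since only a complemented tail attains the value \<open>1\<close> and at most one is complemented. By \<open>carry_step\<close>, a column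
  with sum at least \<open>10\<close> makes the sum of the tails just above it at least \<open>1\<close>, a column with sum at
  most \<open>8\<close> makes it less than \<open>1\<close>, and a column with sum \<open>9\<close> leaves unchanged whether it is at least \<open>1\<close>.
\<close>

lemma carry_decided:
  assumes de: "d \<in> decimals" "e \<in> decimals" and c: "\<not> (c1 \<and> c2)"
    and first: "\<And>i. j < i \<Longrightarrow> i < n \<Longrightarrow> column c1 c2 d e i = 9"
    and "column c1 c2 d e j \<noteq> 9" "j < n"
  shows "\<lfloor>tail c1 d n + tail c2 e n\<rfloor> = (if column c1 c2 d e j > 9 then 1 else 0)"
proof -
  let ?t = "\<lambda>i. tail c1 d i + tail c2 e i" and ?v = "column c1 c2 d e j"
  have t: "0 \<le> ?t i" "?t i < 2" for i
    using c tail_bounds[where c = c1 and d = d and n = i] tail_bounds[where c = c2 and d = e and n = i]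
    by force+
  have "j + 1 \<le> n" using \<open>j < n\<close> by simp
  then have "(\<forall>i. j < i \<longrightarrow> i < n \<longrightarrow> column c1 c2 d e i = 9) \<longrightarrow> (1 \<le> ?t n \<longleftrightarrow> 9 < ?v)"
  proof (induction n rule: int_ge_induct)
    case base
    have "10 * ?t (j + 1) = real ?v + ?t j" by (rule carry_step[OF de])
    with assms(5) t[of j] show ?case by (cases "?v > 9") auto
  next
    case (step i)
    show ?case
    proof
      assume nine: "\<forall>k. j < k \<longrightarrow> k < i + 1 \<longrightarrow> column c1 c2 d e k = 9"
      then have "10 * ?t (i + 1) = 9 + ?t i" using carry_step[OF de, of c1 i c2] step.hyps by simp
      moreover have "1 \<le> ?t i \<longleftrightarrow> 9 < ?v" using step.IH nine by auto
      ultimately show "1 \<le> ?t (i + 1) \<longleftrightarrow> 9 < ?v" by auto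
    qed
  qed
  then have "1 \<le> ?t n \<longleftrightarrow> 9 < ?v" using first by blast
  then show ?thesis using t[of n] by (auto simp: floor_eq_iff)
qed

lemma carry_bounded: "\<bar>tail c1 d n + tail c2 e n - 1\<bar> \<le> 1"
  using tail_bounds[where c = c1 and d = d and n = n] tail_bounds[where c = c2 and d = e and n = n]
  by (auto simp: abs_le_iff)

lemma sum_magnitude:
  assumes "d \<in> decimals" "e \<in> decimals"
  defines "s \<equiv> decimal_add d e"
  shows "magnitude s = (if dec_neg s \<noteq> dec_neg d then -1 else 1) * magnitude d
           + (if dec_neg s \<noteq> dec_neg e then -1 else 1) * magnitude e"
proof -
  have "decimal_value s = decimal_value d + decimal_value e"
    using decimal_add[OF assms(1,2)] by (simp add: s_def)
  then show ?thesis by (auto simp: decimal_value_def)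
qed

text \<open>
  If both operands had the sign opposite to that of the sum, then all three would vanish, but zero
  carries no sign.
\<close>

lemma sum_signs:
  assumes de: "d \<in> decimals" "e \<in> decimals"
  defines "s \<equiv> decimal_add d e"
  shows "\<not> (dec_neg s \<noteq> dec_neg d \<and> dec_neg s \<noteq> dec_neg e)"
proof
  assume opp: "dec_neg s \<noteq> dec_neg d \<and> dec_neg s \<noteq> dec_neg e"
  have s: "s \<in> decimals" unfolding s_def by (rule decimal_add[OF de])
  have "magnitude s = - magnitude d - magnitude e"
    using sum_magnitude[OF de, folded s_def] opp by simp
  then have "magnitude s = 0" "magnitude d = 0"
    using magnitude_nonneg[OF s] magnitude_nonneg[OF de(1)] magnitude_nonneg[OF de(2)] by linarith+
  then have "\<not> dec_neg s" "\<not> dec_neg d"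
    using neg_iff_value[OF s] neg_iff_value[OF de(1)] abs_decimal_value[OF s]
      abs_decimal_value[OF de(1)] by linarith+
  with opp show False by simp
qed

text \<open>
  The integral part that \<open>signed_magnitude_tail\<close> assigns to an operand has the possibly complemented
  digit as its last digit.
\<close>

lemma nines_complement_mod:
  assumes "d \<in> decimals"
  shows "(if c then - prefix_value d n - 1 else prefix_value d n) mod 10
           = int (nines_complement c (dec_digit d n)) mod 10"
proof -
  have "(- q - 1) mod 10 = (9 - q mod 10) mod 10" for q :: int
  proof -
    have "(9 - q mod 10) mod 10 = (9 - q) mod 10" by (rule mod_diff_right_eq)
    also have "9 - q = (- q - 1) + 10" by simp
    finally show ?thesis by (simp only: mod_add_self2)
  qed
  then show ?thesis using digit_le_9[OF assms, of n]
    by (simp add: nines_complement_def of_nat_diff digit_eq_prefix_mod[OF assms])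
qed

text \<open>
  The operands are split separately, so that the carry into position \<open>n\<close> is what the two tails contribute
  to the integral part of the sum.
\<close>

lemma sum_quotient:
  assumes de: "d \<in> decimals" "e \<in> decimals"
  defines "s \<equiv> decimal_add d e"
  defines "c1 \<equiv> dec_neg s \<noteq> dec_neg d" and "c2 \<equiv> dec_neg s \<noteq> dec_neg e"
  obtains z :: int where
    "magnitude s / 10 powi n = of_int z + (tail c1 d n + tail c2 e n)"
    "z mod 10 = int (column c1 c2 d e n) mod 10"
proof
  let ?z = "\<lambda>c d. if c then - prefix_value d n - 1 else prefix_value d n"
  have "magnitude s = (if c1 then -1 else 1) * magnitude d + (if c2 then -1 else 1) * magnitude e"
    unfolding c1_def c2_def s_def by (rule sum_magnitude[OF de])
  then have "magnitude s / 10 powi n = (if c1 then -1 else 1) * (magnitude d / 10 powi n)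
      + (if c2 then -1 else 1) * (magnitude e / 10 powi n)"
    by (simp add: add_divide_distrib diff_divide_distrib)
  then show "magnitude s / 10 powi n = of_int (?z c1 d + ?z c2 e) + (tail c1 d n + tail c2 e n)"
    by (simp only: signed_magnitude_tail floor_magnitude[OF de(1)] floor_magnitude[OF de(2)] of_int_add)
  show "(?z c1 d + ?z c2 e) mod 10 = int (column c1 c2 d e n) mod 10"
    unfolding column_def of_nat_add
    by (intro mod_add_cong nines_complement_mod de)
qed

lemma sum_digit:
  assumes de: "d \<in> decimals" "e \<in> decimals"
  defines "s \<equiv> decimal_add d e"
  defines "c1 \<equiv> dec_neg s \<noteq> dec_neg d" and "c2 \<equiv> dec_neg s \<noteq> dec_neg e"
  assumes "j < n" "column c1 c2 d e j \<noteq> 9"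
    and first: "\<And>i. j < i \<Longrightarrow> i < n \<Longrightarrow> column c1 c2 d e i = 9"
  shows "dec_digit s n
           = (column c1 c2 d e n + (if column c1 c2 d e j > 9 then 1 else 0)) mod 10"
proof -
  let ?k = "if column c1 c2 d e j > 9 then 1 else 0 :: int"
  have s: "s \<in> decimals" unfolding s_def by (rule decimal_add[OF de])
  obtain z where z: "magnitude s / 10 powi n = of_int z + (tail c1 d n + tail c2 e n)"
    and zm: "z mod 10 = int (column c1 c2 d e n) mod 10"
    unfolding c1_def c2_def s_def using sum_quotient[OF de] .
  have "\<not> (c1 \<and> c2)" unfolding c1_def c2_def s_def by (rule sum_signs[OF de])
  from carry_decided[OF de this first assms(7,6)]
  have "\<lfloor>magnitude s / 10 powi n\<rfloor> = z + ?k" unfolding z by simp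
  then have "int (dec_digit s n) = (z + ?k) mod 10" by (simp only: digit_eq_floor[OF s])
  also have "\<dots> = (int (column c1 c2 d e n) + ?k) mod 10" by (rule mod_add_cong[OF zm refl])
  also have "\<dots> = int ((column c1 c2 d e n + (if column c1 c2 d e j > 9 then 1 else 0)) mod 10)"
    by (simp add: zmod_int)
  finally show ?thesis by (simp only: of_nat_eq_iff)
qed

text \<open>
  Without a decisive column both tails add up to exactly \<open>1\<close>, by \<open>tenfold_bounded_imp_zero\<close>, and nothing
  remains below the integral part of the sum.
\<close>

lemma sum_terminates:
  assumes de: "d \<in> decimals" "e \<in> decimals"
  defines "s \<equiv> decimal_add d e"
  defines "c1 \<equiv> dec_neg s \<noteq> dec_neg d" and "c2 \<equiv> dec_neg s \<noteq> dec_neg e"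
  assumes nines: "\<And>i. i < n \<Longrightarrow> column c1 c2 d e i = 9" and "i < n"
  shows "dec_digit s i = 0"
proof -
  have s: "s \<in> decimals" unfolding s_def by (rule decimal_add[OF de])
  let ?g = "\<lambda>i. tail c1 d i + tail c2 e i - 1"
  have "?g (i + 1) = 0"
  proof (rule tenfold_bounded_imp_zero[where B = 1])
    fix m assume "m < i + 1"
    then show "?g m = 10 * ?g (m + 1)"
      using carry_step[OF de, of c1 m c2] nines[of m] \<open>i < n\<close> by simp
  qed (rule carry_bounded)
  moreover obtain z where "magnitude s / 10 powi (i + 1)
      = of_int z + (tail c1 d (i + 1) + tail c2 e (i + 1))"
    unfolding c1_def c2_def s_def using sum_quotient[OF de] .
  ultimately have "magnitude s / 10 powi (i + 1) = of_int (z + 1)" by simp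
  then have "magnitude s / 10 powi i = of_int (10 * (z + 1))" by (simp add: powi_Suc)
  then have "\<lfloor>magnitude s / 10 powi i\<rfloor> = 10 * (z + 1)" by (simp only: floor_of_int)
  then have "int (dec_digit s i) = 0" by (simp add: digit_eq_floor[OF s])
  then show ?thesis by simp
qed

section \<open>The machine\<close>

instance symbol :: countable
  by countable_datatype

text \<open>
  The language in which \<open>h\<close> is written. \<open>Emit s\<close> offers the next letter of the result, \<open>Zeros\<close> is the end of
  a program whose remaining output is constantly \<open>0\<close>, and \<open>Columns c1 c2\<close> starts the column addition at
  the current cells of the input heads, with complementation flags for the two operands.
\<close>

datatype instruction = Emit symbol | Advance1 | Advance2 | Zeros | Columns bool bool

text \<open>
  \<open>Decrement\<close> and \<open>Rewind\<close> count \<open>m\<close> down; \<open>Fetch k\<close> has read \<open>k\<close> ones of the current opcode;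
  \<open>Resolve c1 c2 r\<close> remembers the last digit \<open>r\<close> of the sum of the column of interest while it looks for
  a decisive column; \<open>Finish\<close>, \<open>Erase\<close> and \<open>Write\<close> move to the right end of the third tape, clear it
  from there to the left, and write the result.
\<close>

datatype control =
  Start | Decrement | Rewind | Fetch nat | Resolve bool bool nat
| Finish symbol | Erase symbol | Write symbol | Halt

instance control :: countable
  by countable_datatype

text \<open>
  The opcode of an instruction is its position in this list, in unary. By \<open>sum_signs\<close>, at most one
  operand has to be complemented.
\<close>

definition instructions :: "instruction list" where
  "instructions = map Emit (map Digit [0..<10] @ [Minus, Xi]) @
     [Advance1, Advance2, Zeros, Columns False False, Columns False True, Columns True False]"

fun digit_value :: "symbol \<Rightarrow> nat" where
  "digit_value (Digit n) = n"
| "digit_value _ = 0"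

definition symbol_column :: "bool \<Rightarrow> bool \<Rightarrow> symbol \<Rightarrow> symbol \<Rightarrow> nat" where
  "symbol_column c1 c2 a b =
     nines_complement c1 (digit_value a) + nines_complement c2 (digit_value b)"

fun execute :: "instruction \<Rightarrow> symbol \<Rightarrow> symbol \<Rightarrow> control \<times> move \<times> move" where
  "execute (Emit s) a b = (if a = Blank then (Finish s, Stay, Stay) else (Fetch 0, Bwd, Bwd))"
| "execute Advance1 a b = (Fetch 0, Fwd, Stay)"
| "execute Advance2 a b = (Fetch 0, Stay, Fwd)"
| "execute Zeros a b = (Finish (Digit 0), Stay, Stay)"
| "execute (Columns c1 c2) a b = (Resolve c1 c2 (symbol_column c1 c2 a b mod 10), Fwd, Fwd)"

fun transition ::
  "control \<Rightarrow> symbol \<Rightarrow> symbol \<Rightarrow> symbol \<Rightarrow> control \<times> symbol \<times> move \<times> move \<times> move" where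
  "transition Start a b c = (Decrement, c, Bwd, Bwd, Stay)"
| "transition Decrement a b c =
     (if c = Digit 0 then (Decrement, Digit 1, Stay, Stay, Fwd)
      else if c = Digit 1 then (Rewind, Digit 0, Fwd, Fwd, Stay)
      else (Fetch 0, c, Stay, Stay, Fwd))"
| "transition Rewind a b c =
     (if c = Blank then (Decrement, c, Stay, Stay, Fwd) else (Rewind, c, Stay, Stay, Bwd))"
| "transition (Fetch k) a b c =
     (if c = Digit 0 then
        case execute (instructions ! k) a b of (q, m1, m2) \<Rightarrow> (q, c, m1, m2, Fwd)
      else if Suc k < length instructions then (Fetch (Suc k), c, Stay, Stay, Fwd)
      else (Halt, c, Stay, Stay, Stay))"
| "transition (Resolve c1 c2 r) a b c =
     (let v = symbol_column c1 c2 a b in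
      if v = 9 then (Resolve c1 c2 r, c, Fwd, Fwd, Stay)
      else (Finish (Digit ((r + (if v > 9 then 1 else 0)) mod 10)), c, Stay, Stay, Stay))"
| "transition (Finish s) a b c =
     \<comment> \<open>the used part of the third tape contains no blanks, so its two ends can be found\<close>
     (if c = Blank then (Erase s, c, Stay, Stay, Bwd) else (Finish s, c, Stay, Stay, Fwd))"
| "transition (Erase s) a b c =
     (if c = Blank then (Write s, c, Stay, Stay, Fwd) else (Erase s, Blank, Stay, Stay, Bwd))"
| "transition (Write s) a b c = (Halt, s, Stay, Stay, Stay)"
| "transition Halt a b c = (Halt, c, Stay, Stay, Stay)"

definition controls :: "control set" where
  "controls = {Start, Decrement, Rewind, Halt} \<union> Fetch ` {..<length instructions} \<union>
     (\<lambda>(c1, c2, r). Resolve c1 c2 r) ` (UNIV \<times> UNIV \<times> {..<10}) \<union>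
     (Finish ` decimal_alphabet \<union> Erase ` decimal_alphabet \<union> Write ` decimal_alphabet)"

text \<open>
  The structured control states are numbered by an arbitrary injection into the natural numbers.
\<close>

definition addition_machine :: machine where
  "addition_machine =
     \<lparr> states = to_nat ` controls,
       initial = to_nat Start,
       terminal = to_nat Halt,
       tape_symbols = decimal_alphabet \<union> {Blank, Sep},
       instr = (\<lambda>q a b c. map_prod to_nat id (transition (from_nat q) a b c)) \<rparr>"

lemma alphabet_simps:
  "Digit n \<in> decimal_alphabet \<longleftrightarrow> n < 10"
  "Minus \<in> decimal_alphabet" "Xi \<in> decimal_alphabet"
  "Blank \<notin> decimal_alphabet" "Sep \<notin> decimal_alphabet"
  by (auto simp: decimal_alphabet_def)

lemma instructions_set:
  "set instructions = Emit ` decimal_alphabet \<union>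
     {Advance1, Advance2, Zeros, Columns False False, Columns False True, Columns True False}"
proof -
  have "Digit ` {0..<10} = Digit ` {0..9}" by (rule arg_cong[where f = "(`) Digit"]) auto
  then show ?thesis by (auto simp: instructions_def decimal_alphabet_def)
qed

lemma controls_simps:
  "Start \<in> controls" "Decrement \<in> controls" "Rewind \<in> controls" "Halt \<in> controls"
  "Fetch k \<in> controls \<longleftrightarrow> k < length instructions"
  "Resolve c1 c2 r \<in> controls \<longleftrightarrow> r < 10"
  "Finish s \<in> controls \<longleftrightarrow> s \<in> decimal_alphabet"
  "Erase s \<in> controls \<longleftrightarrow> s \<in> decimal_alphabet"
  "Write s \<in> controls \<longleftrightarrow> s \<in> decimal_alphabet"
  by (simp_all add: controls_def image_iff)

lemma transition_closed:
  assumes "q \<in> controls" "c \<in> decimal_alphabet \<union> {Blank, Sep}"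
  shows "case transition q a b c of (q', c', _) \<Rightarrow>
           q' \<in> controls \<and> c' \<in> decimal_alphabet \<union> {Blank, Sep}"
proof -
  have first: "0 < length instructions" by (simp add: instructions_def)
  have exec: "fst (execute i a b) \<in> controls" if "i \<in> set instructions" for i
    using that first unfolding instructions_set by (auto simp: alphabet_simps controls_simps)
  show ?thesis
  proof (cases q)
    case (Fetch k)
    then have "fst (execute (instructions ! k) a b) \<in> controls"
      using assms(1) by (intro exec nth_mem) (simp add: controls_simps)
    then show ?thesis using Fetch assms
      by (auto simp: controls_simps split: prod.split)
  qed (use assms first in \<open>auto simp: controls_simps alphabet_simps Let_def\<close>)
qed

lemma addition_machine_wf: "wf_machine decimal_alphabet addition_machine"
proof -
  have "finite decimal_alphabet" by (simp add: decimal_alphabet_def)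
  moreover from this have "finite controls" by (simp add: controls_def)
  moreover have "Start \<in> controls" "Halt \<in> controls" by (simp_all add: controls_simps)
  moreover have "case instr addition_machine q a b c of
      (q', c', _) \<Rightarrow> q' \<in> states addition_machine \<and> c' \<in> tape_symbols addition_machine"
    if q: "q \<in> states addition_machine - {terminal addition_machine}"
      and c: "c \<in> tape_symbols addition_machine" for q a b c
  proof -
    obtain x where "q = to_nat x" "x \<in> controls" using q by (auto simp: addition_machine_def)
    then show ?thesis
      using transition_closed[of x c a b] c by (auto simp: addition_machine_def split: prod.splits)
  qed
  ultimately show ?thesis
    unfolding wf_machine_def
    by (intro conjI ballI) (simp_all add: addition_machine_def alphabet_simps subset_iff)
qed

section \<open>Runs of the machine\<close>

text \<open>
  Lists that differ in trailing blanks give the same snapshot; this is how cells at the right end are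
  erased and written.
\<close>

definition snapshot :: "control \<Rightarrow> int \<Rightarrow> int \<Rightarrow> int \<Rightarrow> symbol list \<Rightarrow> config" where
  "snapshot q i j p w =
     \<lparr> state = to_nat q, head1 = i, head2 = j, head3 = p, work_tape = list_tape w \<rparr>"

definition runs :: "tape \<Rightarrow> tape \<Rightarrow> config \<Rightarrow> config \<Rightarrow> bool" where
  "runs T1 T2 c c' \<longleftrightarrow> (\<exists>t. (step addition_machine T1 T2 ^^ t) c = c')"

lemma runs_refl: "runs T1 T2 c c"
  unfolding runs_def by (rule exI[of _ 0]) simp

lemma runs_trans [trans]: "runs T1 T2 c c' \<Longrightarrow> runs T1 T2 c' c'' \<Longrightarrow> runs T1 T2 c c''"
  unfolding runs_def by (metis funpow_add comp_apply)

lemma runs_step: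
  assumes "q \<noteq> Halt" "transition q (T1 i) (T2 j) (list_tape w p) = (q', s, m1, m2, m3)"
    and "(list_tape w)(p := s) = list_tape w'"
  shows "runs T1 T2 (snapshot q i j p w)
           (snapshot q' (i + shift m1) (j + shift m2) (p + shift m3) w')"
  unfolding runs_def
  by (rule exI[of _ 1]) (use assms in \<open>simp add: step_def snapshot_def addition_machine_def\<close>)

lemma list_tape_Blank: "p < 0 \<or> p \<ge> int (length w) \<Longrightarrow> list_tape w p = Blank"
  by (auto simp: list_tape_def)

lemma list_tape_at [simp]: "list_tape (u @ a # v) (int (length u)) = a"
  by (simp add: list_tape_def)

lemma list_tape_update [simp]:
  "(list_tape (u @ a # v))(int (length u) := s) = list_tape (u @ s # v)"
  by (auto simp: list_tape_def fun_eq_iff nth_append nth_Cons split: nat.split)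

lemma list_tape_snoc_Blank: "list_tape (u @ [Blank]) = list_tape u"
  by (auto simp: list_tape_def fun_eq_iff nth_append less_Suc_eq)

text \<open>
  The form in which single steps are applied: the list is split at the scanned cell, so that no index
  arithmetic is needed.
\<close>

lemma runs_step_at:
  assumes "q \<noteq> Halt" "transition q (T1 i) (T2 j) a = (q', s, m1, m2, m3)"
  shows "runs T1 T2 (snapshot q i j (int (length u)) (u @ a # v))
           (snapshot q' (i + shift m1) (j + shift m2) (int (length u) + shift m3) (u @ s # v))"
  using assms by (intro runs_step) simp_all

lemma runs_step_Blank:
  assumes "q \<noteq> Halt" "transition q (T1 i) (T2 j) Blank = (q', Blank, m1, m2, m3)"
    and "p < 0 \<or> p \<ge> int (length w)"
  shows "runs T1 T2 (snapshot q i j p w)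
           (snapshot q' (i + shift m1) (j + shift m2) (p + shift m3) w)"
proof (rule runs_step[OF assms(1)])
  have "list_tape w p = Blank" using assms(3) by (rule list_tape_Blank)
  then show "transition q (T1 i) (T2 j) (list_tape w p) = (q', Blank, m1, m2, m3)"
    "(list_tape w)(p := Blank) = list_tape w" using assms(2) by (auto simp: fun_upd_idem)
qed

lemma finish_right:
  assumes "Blank \<notin> set v"
  shows "runs T1 T2 (snapshot (Finish s) i j (int (length u)) (u @ v))
           (snapshot (Finish s) i j (int (length (u @ v))) (u @ v))"
  using assms
proof (induction v arbitrary: u)
  case (Cons a v)
  have "a \<noteq> Blank" using Cons.prems by auto
  then have "runs T1 T2 (snapshot (Finish s) i j (int (length u)) (u @ a # v))
      (snapshot (Finish s) i j (int (length (u @ [a]))) ((u @ [a]) @ v))"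
    using runs_step_at[of "Finish s" T1 i T2 j a "Finish s" a Stay Stay Fwd u v]
    by (simp add: algebra_simps)
  also have "runs T1 T2 \<dots> (snapshot (Finish s) i j (int (length (u @ a # v))) (u @ a # v))"
    using Cons.IH[of "u @ [a]"] Cons.prems by simp
  finally show ?case .
qed (simp add: runs_refl)

lemma erase_left:
  assumes "Blank \<notin> set w"
  shows "runs T1 T2 (snapshot (Erase s) i j (int (length w) - 1) w) (snapshot (Erase s) i j (-1) [])"
  using assms
proof (induction w rule: rev_induct)
  case (snoc a w)
  have "a \<noteq> Blank" using snoc.prems by auto
  then have "runs T1 T2 (snapshot (Erase s) i j (int (length w)) (w @ [a]))
      (snapshot (Erase s) i j (int (length w) - 1) (w @ [Blank]))"
    using runs_step_at[of "Erase s" T1 i T2 j a "Erase s" Blank Stay Stay Bwd w "[]"]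
    by simp
  also have "snapshot (Erase s) i j (int (length w) - 1) (w @ [Blank])
      = snapshot (Erase s) i j (int (length w) - 1) w"
    by (simp add: snapshot_def list_tape_snoc_Blank)
  also have "runs T1 T2 \<dots> (snapshot (Erase s) i j (-1) [])" using snoc by simp
  finally show ?case by simp
qed (simp add: runs_refl)

lemma finish_halts:
  assumes "Blank \<notin> set (u @ v)"
  shows "runs T1 T2 (snapshot (Finish s) i j (int (length u)) (u @ v)) (snapshot Halt i j 0 [s])"
proof -
  let ?w = "u @ v"
  have "runs T1 T2 (snapshot (Finish s) i j (int (length u)) ?w)
      (snapshot (Finish s) i j (int (length ?w)) ?w)"
    using assms by (intro finish_right) auto
  also have "runs T1 T2 \<dots> (snapshot (Erase s) i j (int (length ?w) - 1) ?w)"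
    using runs_step_Blank[of "Finish s" T1 i T2 j "Erase s" Stay Stay Bwd "int (length ?w)" ?w] by simp
  also have "runs T1 T2 \<dots> (snapshot (Erase s) i j (-1) [])"
    by (rule erase_left[OF assms])
  also have "runs T1 T2 \<dots> (snapshot (Write s) i j 0 [])"
    using runs_step_Blank[of "Erase s" T1 i T2 j "Write s" Stay Stay Fwd "-1" "[]"] by simp
  also have "\<dots> = snapshot (Write s) i j 0 [Blank]"
    using list_tape_snoc_Blank[of "[]"] by (simp add: snapshot_def)
  also have "runs T1 T2 \<dots> (snapshot Halt i j 0 [s])"
    using runs_step_at[of "Write s" T1 i T2 j Blank Halt s Stay Stay Stay "[]" "[]"] by simp
  finally show ?thesis .
qed

abbreviation bits :: "symbol list \<Rightarrow> bool" where
  "bits u \<equiv> set u \<subseteq> {Digit 0, Digit 1}"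

primrec bit_value :: "symbol list \<Rightarrow> nat" where
  "bit_value [] = 0"
| "bit_value (a # u) = digit_value a + 2 * bit_value u"

lemma bits_binary: "bits (binary n)"
  by (induction n rule: binary.induct) (subst binary.simps, auto)

lemma bit_value_binary: "bit_value (binary n) = n"
  by (induction n rule: binary.induct) (subst binary.simps, auto)

text \<open>
  The first cell is recognised by overshooting to the blank on its left.
\<close>

lemma rewind:
  assumes "Blank \<notin> set (u @ [a])"
  shows "runs T1 T2 (snapshot Rewind i j (int (length u)) (u @ a # v))
           (snapshot Decrement i j 0 (u @ a # v))"
  using assms
proof (induction u arbitrary: a v rule: rev_induct)
  case Nil
  have "runs T1 T2 (snapshot Rewind i j 0 (a # v)) (snapshot Rewind i j (-1) (a # v))"
    using runs_step_at[of Rewind T1 i T2 j a Rewind a Stay Stay Bwd "[]" v] Nil by simp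
  also have "runs T1 T2 \<dots> (snapshot Decrement i j 0 (a # v))"
    using runs_step_Blank[of Rewind T1 i T2 j Decrement Stay Stay Fwd "-1" "a # v"] by simp
  finally show ?case by simp
next
  case (snoc b u)
  have "a \<noteq> Blank" using snoc.prems by auto
  then have "runs T1 T2 (snapshot Rewind i j (int (length (u @ [b]))) ((u @ [b]) @ a # v))
      (snapshot Rewind i j (int (length u)) (u @ b # a # v))"
    using runs_step_at[of Rewind T1 i T2 j a Rewind a Stay Stay Bwd "u @ [b]" v] by simp
  also have "runs T1 T2 \<dots> (snapshot Decrement i j 0 (u @ b # a # v))"
    using snoc by simp
  finally show ?case by simp
qed

lemma decrement_zeros:
  "runs T1 T2 (snapshot Decrement i j (int (length u)) (u @ replicate n (Digit 0) @ v))
     (snapshot Decrement i j (int (length u + n)) (u @ replicate n (Digit 1) @ v))"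
proof (induction n arbitrary: u)
  case (Suc n)
  have "runs T1 T2 (snapshot Decrement i j (int (length u)) (u @ Digit 0 # replicate n (Digit 0) @ v))
      (snapshot Decrement i j (int (length (u @ [Digit 1]))) ((u @ [Digit 1]) @ replicate n (Digit 0) @ v))"
    using runs_step_at[of Decrement T1 i T2 j "Digit 0" Decrement "Digit 1" Stay Stay Fwd u]
    by (simp add: algebra_simps)
  also have "runs T1 T2 \<dots> (snapshot Decrement i j (int (length u + Suc n))
      ((u @ [Digit 1]) @ replicate n (Digit 1) @ v))"
    using Suc.IH[of "u @ [Digit 1]"] by simp
  finally show ?case by simp
qed (simp add: runs_refl)

lemma bits_cases:
  assumes "bits u"
  obtains "u = replicate (length u) (Digit 0)" "bit_value u = 0"
  | n v where "u = replicate n (Digit 0) @ Digit 1 # v"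
  using assms
proof (induction u arbitrary: thesis)
  case (Cons a u)
  then consider "a = Digit 1" | "a = Digit 0" by auto
  then show ?case
  proof cases
    case 1
    then show ?thesis using Cons.prems(2)[of 0 u] by simp
  next
    case 2
    show ?thesis
    proof (rule Cons.IH)
      show "bits u" using Cons.prems(3) by simp
      show thesis if "u = replicate (length u) (Digit 0)" "bit_value u = 0"
        using that 2 Cons.prems(1) by simp
      show thesis if "u = replicate n (Digit 0) @ Digit 1 # v" for n v
        using that 2 Cons.prems(2)[of "Suc n" v] by simp
    qed
  qed
qed simp

lemma bit_value_decrement:
  "bit_value (replicate n (Digit 0) @ Digit 1 # v) = Suc (bit_value (replicate n (Digit 1) @ Digit 0 # v))"
  by (induction n) auto

text \<open>
  A decrement turns the leading zeros of \<open>u\<close>, which is written with its least significant digit first,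
  into ones, and the following one into a zero. If all digits are zero, then the value was \<open>0\<close> and the head
  runs into the separator, leaving ones behind; these are nonblank, as the final clearing of the tape
  requires. Each successful decrement moves both input heads forward.
\<close>

lemma countdown:
  assumes "bits u"
  shows "\<exists>u'. length u' = length u \<and> bits u' \<and>
    runs T1 T2 (snapshot Decrement i j 0 (u @ Sep # w))
      (snapshot (Fetch 0) (i + int (bit_value u)) (j + int (bit_value u))
         (int (length (u' @ [Sep]))) (u' @ Sep # w))"
  using assms
proof (induction "bit_value u" arbitrary: u i j rule: less_induct)
  case less
  from less.prems show ?case
  proof (cases u rule: bits_cases)
    case 1
    define n where "n = length u"
    have "runs T1 T2 (snapshot Decrement i j 0 (u @ Sep # w))
        (snapshot Decrement i j (int n) (replicate n (Digit 1) @ Sep # w))"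
      using decrement_zeros[of T1 T2 i j "[]" n "Sep # w"] 1(1) by (simp add: n_def)
    also have "runs T1 T2 \<dots> (snapshot (Fetch 0) i j (int (length (replicate n (Digit 1) @ [Sep])))
        (replicate n (Digit 1) @ Sep # w))"
      using runs_step_at[of Decrement T1 i T2 j Sep "Fetch 0" Sep Stay Stay Fwd "replicate n (Digit 1)" w]
      by (simp add: algebra_simps)
    finally show ?thesis using 1(2) by (intro exI[of _ "replicate n (Digit 1)"]) (auto simp: n_def)
  next
    case (2 n v)
    let ?u = "replicate n (Digit 1) @ Digit 0 # v"
    have "runs T1 T2 (snapshot Decrement i j 0 (u @ Sep # w))
        (snapshot Decrement i j (int n) (replicate n (Digit 1) @ Digit 1 # v @ Sep # w))"
      using decrement_zeros[of T1 T2 i j "[]" n "Digit 1 # v @ Sep # w"] by (simp add: 2)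
    also have "runs T1 T2 \<dots> (snapshot Rewind (i + 1) (j + 1) (int n) (?u @ Sep # w))"
      using runs_step_at[of Decrement T1 i T2 j "Digit 1" Rewind "Digit 0" Fwd Fwd Stay
          "replicate n (Digit 1)" "v @ Sep # w"] by simp
    also have "runs T1 T2 \<dots> (snapshot Decrement (i + 1) (j + 1) 0 (?u @ Sep # w))"
      using rewind[of "replicate n (Digit 1)" "Digit 0" T1 T2 "i + 1" "j + 1" "v @ Sep # w"] by auto
    finally have run: "runs T1 T2 (snapshot Decrement i j 0 (u @ Sep # w))
        (snapshot Decrement (i + 1) (j + 1) 0 (?u @ Sep # w))" .
    have val: "bit_value u = Suc (bit_value ?u)" unfolding 2 by (rule bit_value_decrement)
    have "bits ?u" using less.prems by (auto simp: 2)
    then obtain u' where "length u' = length ?u" "bits u'"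
      "runs T1 T2 (snapshot Decrement (i + 1) (j + 1) 0 (?u @ Sep # w))
        (snapshot (Fetch 0) (i + 1 + int (bit_value ?u)) (j + 1 + int (bit_value ?u))
         (int (length (u' @ [Sep]))) (u' @ Sep # w))"
      using less.hyps[of ?u "i + 1" "j + 1"] val by auto
    with runs_trans[OF run this(3)] val show ?thesis
      by (intro exI[of _ u']) (simp add: 2 algebra_simps)
  qed
qed

definition opcode :: "instruction \<Rightarrow> symbol list" where
  "opcode c = replicate (SOME k. k < length instructions \<and> instructions ! k = c) (Digit 1) @ [Digit 0]"

text \<open>
  The final digit \<open>1\<close> makes the code the binary notation of a positive number, whatever the program.
\<close>

definition program_code :: "instruction list \<Rightarrow> symbol list" where
  "program_code cs = concat (map opcode cs) @ [Digit 1]"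

lemma opcode:
  assumes "c \<in> set instructions"
  obtains k where "k < length instructions" "instructions ! k = c"
    "opcode c = replicate k (Digit 1) @ [Digit 0]"
proof -
  let ?P = "\<lambda>k. k < length instructions \<and> instructions ! k = c"
  have "\<exists>k. ?P k" using assms by (simp add: in_set_conv_nth)
  then have "?P (SOME k. ?P k)" by (rule someI_ex)
  then show thesis using that by (auto simp: opcode_def)
qed

lemma bits_program_code: "bits (program_code cs)"
  by (auto simp: program_code_def opcode_def)

text \<open>
  A list of bits is the binary notation of a number as soon as its last, most significant digit is
  \<open>1\<close>, so \<open>h\<close> can carry arbitrary finite information.
\<close>

lemma bits_are_binary:
  assumes "bits u"
  shows "\<exists>h\<ge>1. binary h = u @ [Digit 1]"
  using assms
proof (induction u)
  case Nil
  show ?case by (intro exI[of _ 1]) (simp add: binary.simps)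
next
  case (Cons a u)
  then obtain h where h: "h \<ge> 1" "binary h = u @ [Digit 1]" by auto
  from Cons.prems consider "a = Digit 0" | "a = Digit 1" by auto
  then show ?case
  proof cases
    case 1
    then show ?thesis using h by (intro exI[of _ "2 * h"]) (subst binary.simps, auto)
  next
    case 2
    then show ?thesis using h by (intro exI[of _ "2 * h + 1"]) (subst binary.simps, auto)
  qed
qed

lemma program_code_is_binary: "\<exists>h\<ge>1. binary h = program_code cs"
  unfolding program_code_def using bits_program_code[of cs]
  by (intro bits_are_binary) (auto simp: program_code_def)

lemma fetch_ones:
  assumes "k + n < length instructions"
  shows "runs T1 T2 (snapshot (Fetch k) i j (int (length u)) (u @ replicate n (Digit 1) @ v))
     (snapshot (Fetch (k + n)) i j (int (length (u @ replicate n (Digit 1)))) (u @ replicate n (Digit 1) @ v))"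
  using assms
proof (induction n arbitrary: u k)
  case (Suc n)
  have "runs T1 T2 (snapshot (Fetch k) i j (int (length u)) (u @ Digit 1 # replicate n (Digit 1) @ v))
      (snapshot (Fetch (Suc k)) i j (int (length (u @ [Digit 1]))) ((u @ [Digit 1]) @ replicate n (Digit 1) @ v))"
    using runs_step_at[of "Fetch k" T1 i T2 j "Digit 1" "Fetch (Suc k)" "Digit 1" Stay Stay Fwd u] Suc.prems
    by (simp add: algebra_simps)
  also have "runs T1 T2 \<dots> (snapshot (Fetch (Suc k + n)) i j (int (length ((u @ [Digit 1]) @ replicate n (Digit 1))))
      ((u @ [Digit 1]) @ replicate n (Digit 1) @ v))"
    using Suc.IH[of "Suc k" "u @ [Digit 1]"] Suc.prems by simp
  finally show ?case by (simp add: algebra_simps)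
qed (simp add: runs_refl)

lemma run_instruction:
  assumes "c \<in> set instructions" "execute c (T1 i) (T2 j) = (q, ma, mb)"
  shows "runs T1 T2 (snapshot (Fetch 0) i j (int (length u)) (u @ opcode c @ v))
     (snapshot q (i + shift ma) (j + shift mb) (int (length (u @ opcode c))) (u @ opcode c @ v))"
proof -
  obtain k where k: "k < length instructions" "instructions ! k = c"
    "opcode c = replicate k (Digit 1) @ [Digit 0]"
    using opcode[OF assms(1)] .
  let ?u = "u @ replicate k (Digit 1)"
  have "runs T1 T2 (snapshot (Fetch 0) i j (int (length u)) (u @ opcode c @ v))
      (snapshot (Fetch k) i j (int (length ?u)) (?u @ Digit 0 # v))"
    using fetch_ones[of 0 k T1 T2 i j u "Digit 0 # v"] k by simp
  also have "runs T1 T2 \<dots> (snapshot q (i + shift ma) (j + shift mb) (int (length ?u) + 1) (?u @ Digit 0 # v))"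
    using runs_step_at[of "Fetch k" T1 i T2 j "Digit 0" q "Digit 0" ma mb Fwd ?u v] assms k by simp
  finally show ?thesis using k by (simp add: algebra_simps)
qed

text \<open>
  The list \<open>u\<close> stands for what lies to the left of the remaining program: the exhausted counter, the
  separator and the instructions already executed. Quantifying over it makes the effects of successive
  instructions composable.
\<close>

definition outputs :: "tape \<Rightarrow> tape \<Rightarrow> int \<Rightarrow> int \<Rightarrow> instruction list \<Rightarrow> symbol \<Rightarrow> bool" where
  "outputs T1 T2 i j cs s \<longleftrightarrow>
     (\<forall>u. Blank \<notin> set u \<longrightarrow>
        (\<exists>i' j' p. runs T1 T2 (snapshot (Fetch 0) i j (int (length u)) (u @ program_code cs))
          (snapshot Halt i' j' p [s])))"

lemma Blank_not_bits: "bits u \<Longrightarrow> Blank \<notin> set u"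
  by auto

lemma bits_opcode: "bits (opcode c)"
  by (auto simp: opcode_def)

lemma program_code_Cons: "program_code (c # cs) = opcode c @ program_code cs"
  by (simp add: program_code_def)

lemma outputs_step:
  assumes "c \<in> set instructions" "execute c (T1 i) (T2 j) = (Fetch 0, ma, mb)"
    and "outputs T1 T2 (i + shift ma) (j + shift mb) cs s"
  shows "outputs T1 T2 i j (c # cs) s"
  unfolding outputs_def
proof (intro allI impI)
  fix u :: "symbol list" assume "Blank \<notin> set u"
  then have "Blank \<notin> set (u @ opcode c)" using Blank_not_bits[OF bits_opcode[of c]] by simp
  with assms(3) obtain i' j' p where
    "runs T1 T2 (snapshot (Fetch 0) (i + shift ma) (j + shift mb) (int (length (u @ opcode c)))
       ((u @ opcode c) @ program_code cs)) (snapshot Halt i' j' p [s])"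
    unfolding outputs_def by blast
  with run_instruction[of c T1 i T2 j "Fetch 0" ma mb, OF assms(1,2), of u "program_code cs"] runs_trans
  show "\<exists>i' j' p. runs T1 T2 (snapshot (Fetch 0) i j (int (length u)) (u @ program_code (c # cs)))
      (snapshot Halt i' j' p [s])"
    unfolding program_code_Cons by (metis append.assoc)
qed

text \<open>
  For instructions that settle the result. They must leave the position of the third head and the
  third tape alone, so that the program is still there to be cleared from its right end.
\<close>

lemma outputs_finish:
  assumes "c \<in> set instructions" "execute c (T1 i) (T2 j) = (q, ma, mb)"
    and "\<And>p w. \<exists>i' j'. runs T1 T2 (snapshot q (i + shift ma) (j + shift mb) p w)
          (snapshot (Finish s) i' j' p w)"
  shows "outputs T1 T2 i j (c # cs) s"
  unfolding outputs_def
proof (intro allI impI)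
  fix u :: "symbol list" assume u: "Blank \<notin> set u"
  let ?w = "(u @ opcode c) @ program_code cs"
  have w: "Blank \<notin> set ?w"
    using u Blank_not_bits[OF bits_opcode[of c]] Blank_not_bits[OF bits_program_code[of cs]] by simp
  have "runs T1 T2 (snapshot (Fetch 0) i j (int (length u)) ?w)
      (snapshot q (i + shift ma) (j + shift mb) (int (length (u @ opcode c))) ?w)"
    using run_instruction[of c T1 i T2 j q ma mb, OF assms(1,2), of u "program_code cs"] by simp
  also obtain i' j' where "runs T1 T2 \<dots> (snapshot (Finish s) i' j' (int (length (u @ opcode c))) ?w)"
    using assms(3) by blast
  also have "runs T1 T2 \<dots> (snapshot Halt i' j' 0 [s])" by (rule finish_halts[OF w])
  finally show "\<exists>i' j' p. runs T1 T2 (snapshot (Fetch 0) i j (int (length u)) (u @ program_code (c # cs)))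
      (snapshot Halt i' j' p [s])"
    unfolding program_code_Cons by auto
qed

lemma outputs_Zeros: "outputs T1 T2 i j (Zeros # cs) (Digit 0)"
  by (rule outputs_finish[where q = "Finish (Digit 0)" and ma = Stay and mb = Stay])
    (auto simp: instructions_set intro: runs_refl)

lemma outputs_Emit_here:
  assumes "s \<in> decimal_alphabet" "T1 i = Blank"
  shows "outputs T1 T2 i j (Emit s # cs) s"
  by (rule outputs_finish[where q = "Finish s" and ma = Stay and mb = Stay])
    (use assms in \<open>auto simp: instructions_set intro: runs_refl\<close>)

lemma outputs_Emit_later:
  assumes "s \<in> decimal_alphabet" "T1 i \<noteq> Blank" "outputs T1 T2 (i - 1) (j - 1) cs s'"
  shows "outputs T1 T2 i j (Emit s # cs) s'"
  by (rule outputs_step[where ma = Bwd and mb = Bwd]) (use assms in \<open>auto simp: instructions_set\<close>)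

lemma outputs_Advance1:
  "outputs T1 T2 (i + int n) j cs s \<Longrightarrow> outputs T1 T2 i j (replicate n Advance1 @ cs) s"
proof (induction n arbitrary: i)
  case (Suc n)
  have "outputs T1 T2 (i + 1) j (replicate n Advance1 @ cs) s"
    using Suc by (simp add: algebra_simps)
  then show ?case
    by (auto simp: instructions_set intro: outputs_step[where ma = Fwd and mb = Stay])
qed simp

lemma outputs_Advance2:
  "outputs T1 T2 i (j + int n) cs s \<Longrightarrow> outputs T1 T2 i j (replicate n Advance2 @ cs) s"
proof (induction n arbitrary: j)
  case (Suc n)
  have "outputs T1 T2 i (j + 1) (replicate n Advance2 @ cs) s"
    using Suc by (simp add: algebra_simps)
  then show ?case
    by (auto simp: instructions_set intro: outputs_step[where ma = Stay and mb = Fwd])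
qed simp

lemma resolve:
  assumes "\<And>k. k < n \<Longrightarrow> symbol_column c1 c2 (T1 (i + int k)) (T2 (j + int k)) = 9"
  shows "runs T1 T2 (snapshot (Resolve c1 c2 r) i j p w)
           (snapshot (Resolve c1 c2 r) (i + int n) (j + int n) p w)"
  using assms
proof (induction n)
  case (Suc n)
  have "runs T1 T2 (snapshot (Resolve c1 c2 r) i j p w)
      (snapshot (Resolve c1 c2 r) (i + int n) (j + int n) p w)" using Suc by simp
  also have "runs T1 T2 \<dots>
      (snapshot (Resolve c1 c2 r) (i + int n + shift Fwd) (j + int n + shift Fwd) (p + shift Stay) w)"
    by (rule runs_step[where s = "list_tape w p"]) (use Suc.prems[of n] in auto)
  finally show ?case by (simp add: algebra_simps)
qed (simp add: runs_refl)

lemma outputs_Columns: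
  assumes "\<not> (c1 \<and> c2)"
    and nines: "\<And>k. 0 < k \<Longrightarrow> k < n \<Longrightarrow> symbol_column c1 c2 (T1 (i + int k)) (T2 (j + int k)) = 9"
    and v: "v = symbol_column c1 c2 (T1 (i + int n)) (T2 (j + int n))" "v \<noteq> 9" "n > 0"
    and s: "s = Digit ((symbol_column c1 c2 (T1 i) (T2 j) + (if v > 9 then 1 else 0)) mod 10)"
  shows "outputs T1 T2 i j (Columns c1 c2 # cs) s"
proof (rule outputs_finish)
  let ?r = "symbol_column c1 c2 (T1 i) (T2 j) mod 10"
  show "Columns c1 c2 \<in> set instructions" using assms(1) by (auto simp: instructions_set)
  show "execute (Columns c1 c2) (T1 i) (T2 j) = (Resolve c1 c2 ?r, Fwd, Fwd)" by simp
  fix p w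
  have "runs T1 T2 (snapshot (Resolve c1 c2 ?r) (i + shift Fwd) (j + shift Fwd) p w)
      (snapshot (Resolve c1 c2 ?r) (i + shift Fwd + int (n - 1)) (j + shift Fwd + int (n - 1)) p w)"
    by (rule resolve) (use nines[of "Suc k" for k] in \<open>auto simp: algebra_simps\<close>)
  also have "\<dots> = snapshot (Resolve c1 c2 ?r) (i + int n) (j + int n) p w"
    using v(3) by (simp add: of_nat_diff)
  also have "runs T1 T2 \<dots> (snapshot (Finish s) (i + int n + shift Stay) (j + int n + shift Stay) (p + shift Stay) w)"
    by (rule runs_step[where s = "list_tape w p"]) (use v in \<open>auto simp: s Let_def mod_simps\<close>)
  finally show "\<exists>i' j'. runs T1 T2 (snapshot (Resolve c1 c2 ?r) (i + shift Fwd) (j + shift Fwd) p w)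
      (snapshot (Finish s) i' j' p w)" by auto
qed

text \<open>
  The initial move of both input heads to cell \<open>-1\<close> makes them stand at cell \<open>m - 1\<close> after \<open>m\<close> decrements;
  thus exactly \<open>m\<close> letters can be skipped before the first head scans a blank.
\<close>

lemma outputs_terminates:
  assumes "outputs T1 T2 (int m - 1) (int m - 1) cs s" "binary h = program_code cs"
  shows "terminates_with addition_machine T1 T2 (list_tape (binary m @ [Sep] @ binary h)) (list_tape [s])"
proof -
  let ?w = "binary m @ Sep # program_code cs"
  obtain a w where aw: "?w = a # w" by (cases ?w) auto
  have "runs T1 T2 (snapshot Start 0 0 0 ?w) (snapshot Decrement (-1) (-1) 0 ?w)"
    using runs_step_at[of Start T1 0 T2 0 a Decrement a Bwd Bwd Stay "[]" w] by (simp add: aw)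
  also obtain u where u: "bits u" "runs T1 T2 \<dots>
      (snapshot (Fetch 0) (int m - 1) (int m - 1) (int (length (u @ [Sep]))) ((u @ [Sep]) @ program_code cs))"
    using countdown[OF bits_binary[of m], of T1 T2 "-1" "-1" "program_code cs"]
    by (auto simp: bit_value_binary)
  note u(2)
  also obtain i j p where "runs T1 T2 \<dots> (snapshot Halt i j p [s])"
    using assms(1) Blank_not_bits[OF u(1)] unfolding outputs_def by (metis append_is_Nil_conv
        Un_iff empty_iff insert_iff list.set set_append symbol.distinct)
  finally obtain t where
    "(step addition_machine T1 T2 ^^ t) (snapshot Start 0 0 0 ?w) = snapshot Halt i j p [s]"
    unfolding runs_def by blast
  moreover have "initial_config addition_machine (list_tape ?w) = snapshot Start 0 0 0 ?w"
    by (simp add: initial_config_def snapshot_def addition_machine_def)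
  moreover have "terminal addition_machine = to_nat Halt" by (simp add: addition_machine_def)
  ultimately show ?thesis
    unfolding terminates_with_def assms(2) by (intro exI[of _ t]) (simp add: snapshot_def)
qed

section \<open>Encodings and the program for a sum\<close>

definition header :: "raw_decimal \<Rightarrow> symbol list" where
  "header d = (if dec_neg d then [Minus] else []) @ binary (dec_order d) @ [Xi]"

definition digit_word :: "raw_decimal \<Rightarrow> symbol word" where
  "digit_word d = (\<lambda>i. Digit (dec_digit d (int (dec_order d) - int i)))"

lemma encode_eq: "encode d = header d \<frown> digit_word d"
  by (simp add: encode_def header_def digit_word_def)

text \<open>
  The first occurrence of the separator determines the length of the prefix.
\<close>

lemma conc_separator_inject:
  assumes "(u @ [a]) \<frown> x = (v @ [a]) \<frown> y" "a \<notin> set u" "a \<notin> set v" "a \<notin> range x" "a \<notin> range y"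
  shows "u = v \<and> x = y"
proof -
  have le: "length v \<le> length u"
    if "(u @ [a]) \<frown> x = (v @ [a]) \<frown> y" "a \<notin> set v" for u v :: "'a list" and x y
  proof (rule ccontr)
    assume "\<not> length v \<le> length u"
    then have "((v @ [a]) \<frown> y) (length u) = v ! length u" "v ! length u \<in> set v"
      by (simp_all add: nth_append)
    moreover have "((u @ [a]) \<frown> x) (length u) = a" by simp
    ultimately show False using that by metis
  qed
  have len: "length u = length v"
    using le[OF assms(1,3)] le[OF assms(1)[symmetric] assms(2)] by simp
  have "u ! k = v ! k" if "k < length u" for k
    using fun_cong[OF assms(1), of k] that len by (simp add: nth_append)
  then have "u = v" using len by (simp add: nth_equalityI)
  moreover have "x k = y k" for k
    using fun_cong[OF assms(1), of "Suc (length u) + k"] len by simp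
  ultimately show ?thesis by auto
qed

lemma binary_inject: "binary k = binary l \<Longrightarrow> k = l"
  by (metis bit_value_binary)

lemma encode_inject:
  assumes "d \<in> decimals" "e \<in> decimals" "encode d = encode e"
  shows "d = e"
proof -
  let ?h = "\<lambda>d. (if dec_neg d then [Minus] else []) @ binary (dec_order d)"
  have "?h d = ?h e \<and> digit_word d = digit_word e"
  proof (rule conc_separator_inject[where a = Xi])
    show "(?h d @ [Xi]) \<frown> digit_word d = (?h e @ [Xi]) \<frown> digit_word e"
      using assms(3) by (simp add: encode_eq header_def)
    show "Xi \<notin> set (?h d)" "Xi \<notin> set (?h e)"
      using bits_binary[of "dec_order d"] bits_binary[of "dec_order e"] by auto
  qed (auto simp: digit_word_def)
  then have h: "?h d = ?h e" and w: "digit_word d = digit_word e" by auto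
  have "Minus \<notin> set (binary (dec_order d))" "Minus \<notin> set (binary (dec_order e))"
    using bits_binary[of "dec_order d"] bits_binary[of "dec_order e"] by auto
  then have "Minus \<in> set (?h d) \<longleftrightarrow> dec_neg d" "Minus \<in> set (?h e) \<longleftrightarrow> dec_neg e" by auto
  with h have neg: "dec_neg d = dec_neg e" by simp
  with h have order: "dec_order d = dec_order e" by (auto dest: binary_inject)
  have digit: "dec_digit d n = dec_digit e n" for n
  proof (cases "n \<le> int (dec_order d)")
    case True
    then show ?thesis
      using fun_cong[OF w, of "nat (int (dec_order d) - n)"] order by (simp add: digit_word_def)
  next
    case False
    then show ?thesis using assms(1,2) order by (simp add: decimals_def)
  qed
  show ?thesis using neg order digit by (cases d; cases e) auto
qed

lemma decode_encode: "d \<in> decimals \<Longrightarrow> decode (encode d) = d"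
  unfolding decode_def by (rule the_inv_into_f_f) (auto intro: inj_onI encode_inject)

lemma encode_in_alphabet:
  assumes "d \<in> decimals"
  shows "encode d n \<in> decimal_alphabet"
proof -
  have "set (header d) \<subseteq> decimal_alphabet"
    using bits_binary[of "dec_order d"] by (auto simp: header_def decimal_alphabet_def)
  moreover have "range (digit_word d) \<subseteq> decimal_alphabet"
    using digit_le_9[OF assms] by (auto simp: digit_word_def decimal_alphabet_def)
  ultimately have "range (encode d) \<subseteq> decimal_alphabet" by (simp add: encode_eq)
  then show ?thesis by auto
qed

lemma add_R_encode:
  "d \<in> decimals \<Longrightarrow> e \<in> decimals \<Longrightarrow> add_R (encode d) (encode e) = encode (decimal_add d e)"
  by (simp add: add_R_def decode_encode)

definition units_position :: "raw_decimal \<Rightarrow> nat" where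
  "units_position d = length (header d) + dec_order d"

lemma encode_fraction_digit: "encode d (units_position d + i) = Digit (dec_digit d (- int i))"
  by (simp add: encode_eq units_position_def digit_word_def conc_def)

lemma word_tape_fraction_digit:
  "word_tape (encode d) (int (units_position d + i)) = Digit (dec_digit d (- int i))"
  by (simp add: word_tape_def encode_fraction_digit nat_add_distrib)

lemma word_tape_not_Blank: "d \<in> decimals \<Longrightarrow> i \<ge> 0 \<Longrightarrow> word_tape (encode d) i \<noteq> Blank"
  using encode_in_alphabet[of d "nat i"] by (auto simp: word_tape_def alphabet_simps)

text \<open>
  Emitting a prefix of length \<open>l\<close> either produces the letter with index \<open>m < l\<close>, or leaves the machine
  in the same situation as at the beginning, with \<open>m - l\<close> in place of \<open>m\<close>.
\<close>

lemma outputs_prefix: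
  assumes "d \<in> decimals" "\<And>k. z k \<in> decimal_alphabet"
    and rest: "\<And>k. outputs (word_tape (encode d)) T2 (int k - 1) (int k - 1) cs (z (l + k))"
  shows "outputs (word_tape (encode d)) T2 (int m - 1) (int m - 1) (map (Emit \<circ> z) [0..<l] @ cs) (z m)"
  using rest assms(2)
proof (induction l arbitrary: m z)
  case (Suc l)
  have list: "map (Emit \<circ> z) [0..<Suc l] @ cs
      = Emit (z 0) # map (Emit \<circ> (\<lambda>k. z (Suc k))) [0..<l] @ cs"
    by (simp add: upt_rec[of 0 "Suc l"] map_Suc_upt[symmetric] comp_def del: upt_Suc)
  show ?case
  proof (cases m)
    case 0
    have "word_tape (encode d) (int m - 1) = Blank" using 0 by (simp add: word_tape_def)
    then show ?thesis unfolding list using 0 outputs_Emit_here[OF Suc.prems(2)[of 0]] by simp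
  next
    case (Suc k)
    have "outputs (word_tape (encode d)) T2 (int k - 1) (int k - 1)
        (map (Emit \<circ> (\<lambda>k. z (Suc k))) [0..<l] @ cs) (z (Suc k))"
      by (rule Suc.IH[of "\<lambda>k. z (Suc k)"]) (use Suc.prems in auto)
    then show ?thesis
      unfolding list using Suc
      by (intro outputs_Emit_later Suc.prems(2) word_tape_not_Blank[OF assms(1)]) auto
  qed
qed simp

text \<open>
  The case distinction is not effective; it is made once for the given operands. In the second case the
  stored prefix ends before the units digit of the sum, so that only positions \<open>-k\<close> with \<open>k \<ge> 0\<close> remain.
  At these positions all three words have a digit, whatever their orders are.
\<close>

lemma sum_program:
  assumes de: "d \<in> decimals" "e \<in> decimals"
  shows "\<exists>cs. \<forall>m. outputs (word_tape (encode d)) (word_tape (encode e)) (int m - 1) (int m - 1)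
           cs (encode (decimal_add d e) m)"
proof -
  define s where "s = decimal_add d e"
  have s: "s \<in> decimals" unfolding s_def by (rule decimal_add[OF de])
  let ?z = "encode s" and ?T1 = "word_tape (encode d)" and ?T2 = "word_tape (encode e)"
  have "\<exists>l cs. \<forall>k. outputs ?T1 ?T2 (int k - 1) (int k - 1) cs (?z (l + k))"
  proof (cases "\<exists>l. \<forall>k. ?z (l + k) = Digit 0")
    case True
    then obtain l where "?z (l + k) = Digit 0" for k by blast
    then show ?thesis by (intro exI[of _ l] exI[of _ "[Zeros]"]) (simp add: outputs_Zeros)
  next
    case False
    define c1 where "c1 = (dec_neg s \<noteq> dec_neg d)"
    define c2 where "c2 = (dec_neg s \<noteq> dec_neg e)"
    \<comment> \<open>the heads start at cell k - 1, hence the additional step\<close>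
    let ?cs = "replicate (units_position d + 1) Advance1 @ replicate (units_position e + 1) Advance2
      @ [Columns c1 c2]"
    have "outputs ?T1 ?T2 (int k - 1) (int k - 1) ?cs (?z (units_position s + k))" for k
    proof -
      let ?v = "\<lambda>i. column c1 c2 d e (- int (k + i))"
      have sym: "symbol_column c1 c2 (?T1 (int (units_position d + k) + int i))
          (?T2 (int (units_position e + k) + int i)) = ?v i" for i
        using word_tape_fraction_digit[of d "k + i"] word_tape_fraction_digit[of e "k + i"]
        by (simp add: symbol_column_def column_def add.assoc)
      have "\<exists>i>0. ?v i \<noteq> 9"
      proof (rule ccontr)
        assume "\<not> (\<exists>i>0. ?v i \<noteq> 9)"
        then have nines: "?v i = 9" if "i > 0" for i using that by blast
        have "column c1 c2 d e n = 9" if "n < - int k" for n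
          using nines[of "nat (- int k - n)"] that by simp
        then have "dec_digit s n = 0" if "n < - int k" for n
          using sum_terminates[OF de] that unfolding c1_def c2_def s_def by blast
        then have "?z (units_position s + k + 1 + j) = Digit 0" for j
          using encode_fraction_digit[of s "k + 1 + j"] by (simp add: add.assoc)
        with False show False by blast
      qed
      define n where "n = (LEAST i. i > 0 \<and> ?v i \<noteq> 9)"
      have n: "n > 0" "?v n \<noteq> 9"
        using LeastI_ex[OF \<open>\<exists>i>0. ?v i \<noteq> 9\<close>] by (auto simp: n_def)
      have before: "?v i = 9" if "0 < i" "i < n" for i
        using not_less_Least[of i "\<lambda>i. i > 0 \<and> ?v i \<noteq> 9"] that by (auto simp: n_def)
      have "dec_digit s (- int k) = (?v 0 + (if ?v n > 9 then 1 else 0)) mod 10"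
      proof -
        have "column c1 c2 d e i = 9" if "- int (k + n) < i" "i < - int k" for i
          using before[of "nat (- int k - i)"] that by simp
        then show ?thesis
          using sum_digit[OF de, of "- int (k + n)" "- int k"] n unfolding c1_def c2_def s_def by simp
      qed
      then have digit: "?z (units_position s + k) = Digit ((?v 0 + (if ?v n > 9 then 1 else 0)) mod 10)"
        by (simp add: encode_fraction_digit)
      have "outputs ?T1 ?T2 (int (units_position d + k)) (int (units_position e + k)) [Columns c1 c2]
          (?z (units_position s + k))"
      proof (rule outputs_Columns[where n = n and v = "?v n"])
        show "\<not> (c1 \<and> c2)" unfolding c1_def c2_def s_def by (rule sum_signs[OF de])
        show "?z (units_position s + k) = Digit ((symbol_column c1 c2 (?T1 (int (units_position d + k)))
            (?T2 (int (units_position e + k))) + (if ?v n > 9 then 1 else 0)) mod 10)"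
          using digit sym[of 0] by simp
      qed (use sym before n in auto)
      then show ?thesis
        by (intro outputs_Advance1 outputs_Advance2) (simp add: algebra_simps)
    qed
    then show ?thesis by blast
  qed
  then obtain l cs where rest: "outputs ?T1 ?T2 (int k - 1) (int k - 1) cs (?z (l + k))" for k
    by blast
  show ?thesis
    using outputs_prefix[OF de(1) encode_in_alphabet[OF s] rest] unfolding s_def by blast
qed

theorem theorem4p6:
  shows "weakly_computable decimal_alphabet X_R add_R"
proof -
  have "encoding decimal_alphabet X_R"
    unfolding encoding_def
    using encode_in_alphabet decimal_of_real_in by (auto simp: decimal_alphabet_def X_R_def)
  moreover have "operation X_R add_R"
    using decimal_add(1) by (auto simp: operation_def X_R_def add_R_encode)
  moreover have "weakly_computes X_R add_R addition_machine"
    unfolding weakly_computes_def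
  proof (intro ballI)
    fix x y assume "x \<in> X_R" "y \<in> X_R"
    then obtain d e where de: "d \<in> decimals" "e \<in> decimals" and xy: "x = encode d" "y = encode e"
      by (auto simp: X_R_def)
    obtain cs where cs: "outputs (word_tape x) (word_tape y) (int m - 1) (int m - 1) cs (add_R x y m)" for m
      using sum_program[OF de] by (auto simp: xy add_R_encode[OF de])
    obtain h where "h \<ge> 1" "binary h = program_code cs" using program_code_is_binary by blast
    with outputs_terminates[OF cs]
    show "\<exists>h\<ge>1. \<forall>m. terminates_with addition_machine (word_tape x) (word_tape y)
        (list_tape (binary m @ [Sep] @ binary h)) (list_tape [add_R x y m])" by blast
  qed
  ultimately show ?thesis
    unfolding weakly_computable_def using addition_machine_wf by blast
qed

end
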